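(* Consider Algorithm 1 (described in the context) run by $m$ agents with interaction matrix $L$, reference signals $\{r_i^k\}_{k\ge 0}\subset\mathbb{R}^d$ ($i\in[m]$), weakening factors $\{\chi^k\}$, stepsizes $\{\alpha^k\}$ and noises $\{\zeta_i^k\}$. Suppose that: (A1) $L\in\mathbb{R}^{m\times m}$ is symmetric and satisfies $\mathbf{1}^TL=\mathbf{0}^T$, $L\mathbf{1}=\mathbf{0}$, and $\|I+L-\frac{\mathbf{1}\mathbf{1}^T}{m}\|<1$. (A2) For every $i\in[m]$ and $k\ge 0$, $\mathbb{E}[\zeta_i^k\mid x_i^k]=0$ and $\mathbb{E}[\|\zeta_i^k\|^2\mid x_i^k]=(\sigma_i^k)^2$, where $\sum_{k=0}^\infty(\chi^k)^2\max_{i\in[m]}(\sigma_i^k)^2<\infty$; the noises $\zeta_i^k$ are mutually independent over $i\in[m]$ and $k\ge0$ and independent of the initial states; and $\mathbb{E}[\|x_i^0\|^2]<\infty$ for all $i\in[m]$. (A3) There exist a nonnegative sequence $\{\gamma^k\}$ and a constant $C$ such that $\|r_i^{k+1}-(1-\alpha^k)r_i^k\|\le\gamma^kC$ for all $i\in[m]$ and $k\ge0$, and $\lim_{k\to\infty}\frac{\alpha^k}{\gamma^k}<\infty$. (A4) $\sum_{k=0}^{\infty}\alpha^k=\infty$, $\sum_{k=0}^{\infty}\chi^k=\infty$, $\sum_{k=0}^{\infty}(\chi^k)^2<\infty$, and $\sum_{k=0}^{\infty}\frac{(\gamma^k)^2}{\chi^k}<\infty$. Then the following hold almost surely: 1)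 for every $i\in[m]$, $x_i^k$ converges to $\bar r^k=\frac{1}{m}\sum_{j=1}^m r_j^k$, i.e., $\lim_{k\to\infty}\|x_i^k-\bar r^k\|=0$; 2) $\sum_{k=0}^{\infty}\chi^k\sum_{i=1}^{m}\|x_i^k-\bar x^k\|^2<\infty$; 3) $\sum_{k=0}^{\infty}\gamma^k\sum_{i=1}^{m}\|x_i^k-\bar x^k\|<\infty$, where $\bar x^k=\frac1m\sum_{i=1}^m x_i^k$.
   Context: Setting. There are $m$ agents, $[m]=\{1,\dots,m\}$. The matrix $L=\{L_{ij}\}\in\mathbb{R}^{m\times m}$ describes communication: for $i\ne j$, $L_{ij}>0$ if agents $i$ and $j$ can communicate directly and $L_{ij}=0$ otherwise. The neighbor set of agent $i$ is $\mathbb{N}_i=\{j\neq i: L_{ij}>0\}$, and $L_{ii}=-\sum_{j\in\mathbb{N}_i}L_{ij}$. $\mathbf 1$ is the all-ones vector in $\mathbb{R}^m$, $\|\cdot\|$ is the Euclidean norm for vectors and the induced norm for matrices. Algorithm 1. Parameters: weakening factors $\chi^k>0$ and stepsizes $\alpha^k>0$. Agent $i$ has a (deterministic) reference signal $r_i^k\in\mathbb{R}^d$ and a state $x_i^k\in\mathbb{R}^d$ initialized as $x_i^0=r_i^0$. At each iteration $k=0,1,2,\dots$ every agent $j$ sends $x_j^k+\zeta_j^k$ to its neighbors, where $\zeta_j^k\in\mathbb{R}^d$ is random noise, and every agent $i$ updates $$x_i^{k+1}=(1-\alpha^k)x_i^k+\chi^k\sum_{j\in\mathbb{N}_i}L_{ij}(x_j^k+\zeta_j^k-x_i^k)+r_i^{k+1}-(1-\alpha^k)r_i^k.$$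 *)

theory Defs
  imports "HOL-Probability.Probability"
begin

definition neighbors :: "real^'m^'m \<Rightarrow> 'm \<Rightarrow> 'm set" where
  "neighbors L i = {j. j \<noteq> i \<and> L $ i $ j > 0}"

definition agent_mean :: "('m::finite \<Rightarrow> real^'d) \<Rightarrow> real^'d" where
  "agent_mean f = (1 / real CARD('m)) *\<^sub>R (\<Sum>i\<in>UNIV. f i)"

definition gen_algebra :: "'w measure \<Rightarrow> ('w \<Rightarrow> 'b) \<Rightarrow> 'b measure \<Rightarrow> 'w measure" where
  "gen_algebra M X N = vimage_algebra (space M) X N"

text \<open>
  The library's \<^const>\<open>real_cond_exp\<close> is real-valued; conditional expectations of random
  vectors are taken componentwise.
\<close>

definition vec_cond_exp :: "'w measure \<Rightarrow> 'w measure \<Rightarrow> ('w \<Rightarrow> real^'d) \<Rightarrow> 'w \<Rightarrow> real^'d" where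
  "vec_cond_exp M F f = (\<lambda>\<omega>. \<chi> c. real_cond_exp M F (\<lambda>\<omega>'. f \<omega>' $ c) \<omega>)"

end

theory Submission imports Defs
begin

text \<open>
  The deviations \<open>V\<close> of the states from their average and the difference \<open>U\<close> between the average
  state and the average reference both satisfy linear recursions whose noise is independent, centred
  and square summable in mean. On deviations the mixing step contracts by the factor
  \<open>1 - \<delta> \<chi>\<^sup>k\<close>. Since the noise is uncorrelated with the past, the second moment of
  \<open>V\<close> satisfies a telescoping inequality, so that \<open>\<chi>\<^sup>k |V\<^sup>k|\<^sup>2\<close> has a
  convergent sum of expectations and hence is summable almost surely; the third claim follows by
  AM-GM. For the convergence of \<open>V\<close> and \<open>U\<close> to zero no supermartingale theorem
  is needed: by Kolmogorov's inequality the noise series converges almost surely, and along every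
  such path a deterministic argument applies.
\<close>

section \<open>Deterministic recursions\<close>

text \<open>The damping of the deviations is weak, a multiple of \<open>cw k\<close>, and it has to
  absorb errors of different kinds. The noise series need not converge absolutely, so it is removed
  by subtracting its tail \<open>t\<close>. This costs \<open>t k - T k (t k)\<close>, a part of
  which has the size of \<open>al k\<close>. Neither this part nor the reference drift of size
  \<open>\<gamma> k\<close> is summable in general, or a null sequence times \<open>cw k\<close>.
  What the hypotheses do give is summability of squares divided by \<open>cw k\<close>. This is why
  the recursions are squared: convexity of the square turns a perturbation \<open>c\<close> into
  \<open>c\<^sup>2 / p\<close>, both along a path and in mean. The constant \<delta> is 1 minus the
  norm in A1, because on vectors of sum zero that matrix acts as I + L. Mixing does not damp the
  average, so there the only damping is \<open>al k\<close>; but zero column sums make its drift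
  cancel exactly.\<close>

lemma damped_recursion_tendsto_0:
  fixes u p e b :: "nat \<Rightarrow> real"
  assumes u_nonneg: "\<And>k. 0 \<le> u k"
    and b_nonneg: "\<And>k. 0 \<le> b k" and b_sum: "summable b"
    and p_bounds: "\<forall>\<^sub>F k in sequentially. 0 \<le> p k \<and> p k \<le> 1"
    and p_div: "filterlim (\<lambda>n. \<Sum>k<n. p k) at_top sequentially"
    and e_lim: "e \<longlonglongrightarrow> 0"
    and step: "\<forall>\<^sub>F k in sequentially. u (Suc k) \<le> (1 - p k) * u k + p k * e k + b k"
  shows "u \<longlonglongrightarrow> 0"
proof (rule LIMSEQ_I)
  fix \<epsilon> :: real assume "0 < \<epsilon>"
  then have \<epsilon>3: "0 < \<epsilon> / 3" by simp
  have "\<forall>\<^sub>F k in sequentially. e k < \<epsilon> / 3"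
    using order_tendstoD(2)[OF e_lim \<epsilon>3] .
  moreover have "\<forall>\<^sub>F n in sequentially. (\<Sum>k. b (k + n)) < \<epsilon> / 3"
    using order_tendstoD(2)[OF suminf_exist_split2[OF b_sum] \<epsilon>3] .
  ultimately have "\<forall>\<^sub>F n in sequentially. e n < \<epsilon> / 3 \<and> (0 \<le> p n \<and> p n \<le> 1)
      \<and> u (Suc n) \<le> (1 - p n) * u n + p n * e n + b n \<and> (\<Sum>k. b (k + n)) < \<epsilon> / 3"
    using p_bounds step by eventually_elim auto
  then obtain n where n: "\<And>k. k \<ge> n \<Longrightarrow> e k < \<epsilon> / 3"
      "\<And>k. k \<ge> n \<Longrightarrow> 0 \<le> p k" "\<And>k. k \<ge> n \<Longrightarrow> p k \<le> 1"
      "\<And>k. k \<ge> n \<Longrightarrow> u (Suc k) \<le> (1 - p k) * u k + p k * e k + b k"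
      "(\<Sum>k. b (k + n)) < \<epsilon> / 3"
    unfolding eventually_sequentially by blast
  \<comment> \<open>The null sequence \<open>e\<close> costs no more than \<epsilon>/3 in total,
    since each step forms a convex combination of two quantities controlled by \<epsilon>/3. The
    start value is damped by the product of the \<open>1 - p k\<close>, estimated by an exponential,
    and the terms \<open>b k\<close> accumulate undamped.\<close>
  have bound: "u (n + m) \<le> \<epsilon> / 3 + exp (- (\<Sum>k=n..<n+m. p k)) * u n + (\<Sum>k=n..<n+m. b k)" for m
  proof (induction m)
    case 0
    then show ?case using \<epsilon>3 by simp
  next
    case (Suc m)
    let ?k = "n + m"
    let ?E = "exp (- (\<Sum>k=n..<n+m. p k)) * u n" and ?B = "\<Sum>k=n..<n+m. b k"
    have p: "0 \<le> p ?k" "p ?k \<le> 1" "e ?k < \<epsilon> / 3" using n by auto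
    have "u (Suc ?k) \<le> (1 - p ?k) * u ?k + p ?k * e ?k + b ?k"
      using n(4) by simp
    also have "\<dots> \<le> (1 - p ?k) * (\<epsilon> / 3 + ?E + ?B) + p ?k * (\<epsilon> / 3) + b ?k"
      using p Suc.IH by (intro add_mono mult_left_mono) auto
    also have "\<dots> = \<epsilon> / 3 + (1 - p ?k) * ?E + (1 - p ?k) * ?B + b ?k"
      by (simp add: algebra_simps)
    also have "\<dots> \<le> \<epsilon> / 3 + exp (- p ?k) * ?E + ?B + b ?k"
    proof -
      have "(1 - p ?k) * ?E \<le> exp (- p ?k) * ?E"
        using exp_ge_add_one_self[of "- p ?k"] u_nonneg[of n]
        by (intro mult_right_mono) auto
      moreover have "0 \<le> p ?k * ?B"
        using p by (intro mult_nonneg_nonneg sum_nonneg b_nonneg)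
      then have "(1 - p ?k) * ?B \<le> ?B" by (simp add: left_diff_distrib)
      ultimately show ?thesis by linarith
    qed
    also have "\<dots> = \<epsilon> / 3 + exp (- (\<Sum>k=n..<n+Suc m. p k)) * u n + (\<Sum>k=n..<n+Suc m. b k)"
      by (simp add: mult_exp_exp[symmetric] exp_add exp_diff exp_minus field_simps)
    finally show ?case by simp
  qed
  have b_tail: "(\<Sum>k=n..<n+m. b k) < \<epsilon> / 3" for m
  proof -
    have "(\<Sum>k=n..<n+m. b k) = (\<Sum>k<m. b (k + n))"
      by (rule sum.reindex_bij_witness[of _ "\<lambda>k. k + n" "\<lambda>k. k - n"]) auto
    also have "\<dots> \<le> (\<Sum>k. b (k + n))"
      using b_sum b_nonneg by (intro sum_le_suminf) (auto simp: summable_iff_shift)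
    finally show ?thesis using n(5) by simp
  qed
  \<comment> \<open>With \<open>s\<close> the sum of \<open>p\<close> from \<open>n\<close> on, exp
    s is at least 1 + s, so s \<ge> 3 u(n)/\<epsilon> already pushes the damped start value below
    \<epsilon>/3.\<close>
  obtain N where N: "\<And>j. j \<ge> N \<Longrightarrow> (\<Sum>k<j. p k) \<ge> (\<Sum>k<n. p k) + 3 * u n / \<epsilon>"
    using p_div unfolding filterlim_at_top eventually_sequentially by blast
  have "norm (u j - 0) < \<epsilon>" if "j \<ge> max N n" for j
  proof -
    define m where "m = j - n"
    have j: "j = n + m" using that by (simp add: m_def)
    define s where "s = (\<Sum>k=n..<n+m. p k)"
    have "(\<Sum>k<j. p k) = (\<Sum>k<n. p k) + s"
      unfolding s_def j by (metis le_add1 lessThan_atLeast0 sum.atLeastLessThan_concat zero_le)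
    then have s: "s \<ge> 3 * u n / \<epsilon>" using N[of j] that by simp
    have "exp (- s) * u n \<le> \<epsilon> / 3"
    proof (cases "u n = 0")
      case False
      have "3 * u n / \<epsilon> \<le> exp s"
        using exp_ge_add_one_self[of s] s by linarith
      then show ?thesis
        using \<open>0 < \<epsilon>\<close> by (simp add: exp_minus field_simps)
    qed (use \<epsilon>3 in simp)
    then show ?thesis
      using bound[of m] b_tail[of m] u_nonneg[of j] unfolding s_def[symmetric] j by simp
  qed
  then show "\<exists>no. \<forall>j\<ge>no. norm (u j - 0) < \<epsilon>" by blast
qed

text \<open>Jensen's inequality for the square, with weights \<open>1 - p\<close> and
  \<open>p\<close> at the points \<open>a\<close> and \<open>c / p\<close>.\<close>

lemma convex_square_bound:
  fixes a p c :: real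
  assumes "0 < p" "p \<le> 1"
  shows "((1 - p) * a + c)\<^sup>2 \<le> (1 - p) * a\<^sup>2 + c\<^sup>2 / p"
proof -
  have "(1 - p) * a\<^sup>2 + c\<^sup>2 / p - ((1 - p) * a + c)\<^sup>2 = (1 - p) / p * (p * a - c)\<^sup>2"
    using assms(1) by (simp add: field_simps power2_eq_square)
  moreover have "0 \<le> (1 - p) / p * (p * a - c)\<^sup>2"
    using assms by simp
  ultimately show ?thesis by linarith
qed

text \<open>The perturbation \<open>c\<close> may be neither summable nor a null sequence times
  \<open>p\<close>. After squaring it contributes the summable term
  \<open>(c k)\<^sup>2 / p k\<close>, while \<open>p k * e k\<close> still has the form
  \<open>p k\<close> times a null sequence; the factors 2 come from separating the two inside the
  square.\<close>

lemma damped_recursion_square_tendsto_0: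
  fixes u p e c :: "nat \<Rightarrow> real"
  assumes u_nonneg: "\<And>k. 0 \<le> u k" 
    and p_pos: "\<And>k. 0 < p k"
    and c_sum: "summable (\<lambda>k. (c k)\<^sup>2 / p k)"
    and p_le: "\<forall>\<^sub>F k in sequentially. p k \<le> 1"
    and p_div: "filterlim (\<lambda>n. \<Sum>k<n. p k) at_top sequentially"
    and e_lim: "e \<longlonglongrightarrow> 0"
    and step: "\<forall>\<^sub>F k in sequentially. u (Suc k) \<le> (1 - p k) * u k + (c k + p k * e k)"
  shows "u \<longlonglongrightarrow> 0"
proof -
  have "(\<lambda>k. (u k)\<^sup>2) \<longlonglongrightarrow> 0"
  proof (rule damped_recursion_tendsto_0[where p=p and e="\<lambda>k. 2 * (e k)\<^sup>2" and b="\<lambda>k. 2 * ((c k)\<^sup>2 / p k)"])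
    show "\<forall>\<^sub>F k in sequentially. 0 \<le> p k \<and> p k \<le> 1"
      using p_le by eventually_elim (use p_pos in \<open>auto intro: less_imp_le\<close>)
    show "(\<lambda>k. 2 * (e k)\<^sup>2) \<longlonglongrightarrow> 0"
      using e_lim by (auto intro!: tendsto_eq_intros)
    show "summable (\<lambda>k. 2 * ((c k)\<^sup>2 / p k))"
      using c_sum by (rule summable_mult)
    show "0 \<le> 2 * ((c k)\<^sup>2 / p k)" for k
      using p_pos[of k] by simp
    show "\<forall>\<^sub>F k in sequentially. (u (Suc k))\<^sup>2
        \<le> (1 - p k) * (u k)\<^sup>2 + p k * (2 * (e k)\<^sup>2) + 2 * ((c k)\<^sup>2 / p k)"
      using step p_le
    proof eventually_elim
      case (elim k)
      have "(u (Suc k))\<^sup>2 \<le> ((1 - p k) * u k + (c k + p k * e k))\<^sup>2"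
        using elim u_nonneg[of "Suc k"] by (intro power_mono)
      also have "\<dots> \<le> (1 - p k) * (u k)\<^sup>2 + (c k + p k * e k)\<^sup>2 / p k"
        using elim p_pos by (intro convex_square_bound)
      also have "(c k + p k * e k)\<^sup>2 / p k \<le> (2 * (c k)\<^sup>2 + 2 * (p k * e k)\<^sup>2) / p k"
      proof -
        have "(c k + p k * e k)\<^sup>2 \<le> 2 * (c k)\<^sup>2 + 2 * (p k * e k)\<^sup>2"
          using zero_le_power2[of "c k - p k * e k"] by (simp add: power2_sum power2_diff)
        then show ?thesis using p_pos[of k] by (intro divide_right_mono) auto
      qed
      also have "\<dots> = p k * (2 * (e k)\<^sup>2) + 2 * ((c k)\<^sup>2 / p k)"
        using p_pos[of k] by (simp add: field_simps power2_eq_square)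
      finally show ?case by simp
    qed
  qed (use p_div in auto)
  then have "(\<lambda>k. sqrt ((u k)\<^sup>2)) \<longlonglongrightarrow> 0"
    using tendsto_real_sqrt by fastforce
  then show ?thesis using u_nonneg by (simp add: real_sqrt_abs)
qed

text \<open>The sum of the first \<open>q k\<close> plus the current \<open>u\<close> never exceeds
  the start value plus the sum of all \<open>b k\<close>. It is applied to expectations, where it
  replaces an almost supermartingale argument.\<close>

lemma summable_if_telescoping:
  fixes u q b :: "nat \<Rightarrow> real"
  assumes u_nonneg: "\<And>k. 0 \<le> u k" and q_nonneg: "\<And>k. 0 \<le> q k"
    and b_nonneg: "\<And>k. 0 \<le> b k" and b_sum: "summable b"
    and step: "\<forall>\<^sub>F k in sequentially. u (Suc k) \<le> u k - q k + b k"
  shows "summable q"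
proof -
  obtain K where K: "\<And>k. k \<ge> K \<Longrightarrow> u (Suc k) \<le> u k - q k + b k"
    using step unfolding eventually_sequentially by blast
  have le: "(\<Sum>k<n. q (k + K)) + u (n + K) \<le> u K + (\<Sum>k<n. b (k + K))" for n
  proof (induction n)
    case (Suc n)
    then show ?case using K[of "n + K"] by simp
  qed simp
  have bK: "summable (\<lambda>k. b (k + K))" using b_sum by (simp add: summable_iff_shift)
  have "summable (\<lambda>k. q (k + K))"
  proof (rule summableI_nonneg_bounded[where x="u K + (\<Sum>k. b (k + K))"])
    show "(\<Sum>k<n. q (k + K)) \<le> u K + (\<Sum>k. b (k + K))" for n
      using le[of n] u_nonneg[of "n + K"] sum_le_suminf[OF bK, of "{..<n}"] b_nonneg by auto
  qed (rule q_nonneg)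
  then show ?thesis by (simp add: summable_iff_shift)
qed

text \<open>Subtracting the tail of the convergent noise series turns the recursion into one whose
  perturbation is of relative size \<open>p k\<close> times a null sequence.\<close>

lemma contracting_recursion_tendsto_0:
  fixes v g n :: "nat \<Rightarrow> 'a::real_normed_vector" and T :: "nat \<Rightarrow> 'a \<Rightarrow> 'a"
    and p q c :: "nat \<Rightarrow> real"
  assumes rec: "\<And>k. v (Suc k) = T k (v k) + g k + n k"
    and T_lin: "\<And>k. linear (T k)"
    and T_contr: "\<forall>\<^sub>F k in sequentially. \<forall>w. norm (T k w) \<le> (1 - p k) * norm w"
    and T_id: "\<And>k w. norm (w - T k w) \<le> (K * p k + q k) * norm w"
    and g_le: "\<And>k. norm (g k) \<le> c k"
    and n_conv: "convergent (\<lambda>m. \<Sum>k<m. n k)"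
    and K_nonneg: "0 \<le> K" and q_nonneg: "\<And>k. 0 \<le> q k"
    and p_pos: "\<And>k. 0 < p k"
    and p_le: "\<forall>\<^sub>F k in sequentially. p k \<le> 1"
    and p_div: "filterlim (\<lambda>n. \<Sum>k<n. p k) at_top sequentially"
    and c_sum: "summable (\<lambda>k. (c k)\<^sup>2 / p k)"
    and q_sum: "summable (\<lambda>k. (q k)\<^sup>2 / p k)"
  shows "v \<longlonglongrightarrow> 0"
proof -
  obtain S where S: "(\<lambda>m. \<Sum>k<m. n k) \<longlonglongrightarrow> S"
    using n_conv unfolding convergent_def by blast
  \<comment> \<open>Minus the tail of the noise series: \<open>t\<close> tends to 0 and its
    increments are exactly \<open>n m\<close>, so that \<open>v - t\<close> obeys a recursion
    without noise.\<close>
  define t where "t m = (\<Sum>k<m. n k) - S" for m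
  have t_lim: "t \<longlonglongrightarrow> 0" unfolding t_def using S LIM_zero by blast
  obtain B where B: "B > 0" "\<And>m. norm (t m) \<le> B"
    using convergent_imp_Bseq[OF convergentI[OF t_lim]] unfolding Bseq_def by blast
  define y where "y m = v m - t m" for m
  have y_rec: "y (Suc m) = T m (y m) + g m - (t m - T m (t m))" for m
    unfolding y_def using rec[of m] T_lin[of m]
    by (simp add: t_def linear_diff linear_add algebra_simps)
  have "(\<lambda>m. norm (y m)) \<longlonglongrightarrow> 0"
  \<comment> \<open>The error \<open>t k - T k (t k)\<close> is split: the part proportional to
    \<open>p k\<close> carries the null factor \<open>norm (t k)\<close>, while in the part with
    \<open>q k\<close> only the bound \<open>B\<close> on \<open>t\<close> is kept, as squares of
    \<open>q\<close> over \<open>p\<close> are summable.\<close>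
  proof (rule damped_recursion_square_tendsto_0[where p=p and c="\<lambda>k. c k + B * q k" and e="\<lambda>k. K * norm (t k)"])
    show "(\<lambda>k. K * norm (t k)) \<longlonglongrightarrow> 0"
      using t_lim by (auto intro!: tendsto_eq_intros simp: tendsto_norm_zero_iff)
    show "summable (\<lambda>k. (c k + B * q k)\<^sup>2 / p k)"
    proof (rule summable_comparison_test')
      show "summable (\<lambda>k. 2 * ((c k)\<^sup>2 / p k) + 2 * B\<^sup>2 * ((q k)\<^sup>2 / p k))"
        using c_sum q_sum by (intro summable_add summable_mult)
      fix k
      have "(c k + B * q k)\<^sup>2 \<le> 2 * (c k)\<^sup>2 + 2 * B\<^sup>2 * (q k)\<^sup>2"
        using zero_le_power2[of "c k - B * q k"] by (simp add: power2_sum power2_diff power_mult_distrib)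
      then have "(c k + B * q k)\<^sup>2 / p k \<le> (2 * (c k)\<^sup>2 + 2 * B\<^sup>2 * (q k)\<^sup>2) / p k"
        using p_pos[of k] by (intro divide_right_mono) auto
      then show "norm ((c k + B * q k)\<^sup>2 / p k) \<le> 2 * ((c k)\<^sup>2 / p k) + 2 * B\<^sup>2 * ((q k)\<^sup>2 / p k)"
        using p_pos[of k] by (simp add: add_divide_distrib)
    qed
    show "\<forall>\<^sub>F k in sequentially. norm (y (Suc k))
        \<le> (1 - p k) * norm (y k) + (c k + B * q k + p k * (K * norm (t k)))"
      using T_contr
    proof eventually_elim
      case (elim k)
      have "norm (y (Suc k)) \<le> norm (T k (y k)) + norm (g k) + norm (t k - T k (t k))"
        unfolding y_rec by (rule order_trans[OF norm_triangle_ineq4]) (simp add: norm_triangle_ineq)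
      also have "norm (t k - T k (t k)) \<le> p k * (K * norm (t k)) + q k * norm (t k)"
        using T_id[of "t k" k] by (simp add: algebra_simps)
      also have "q k * norm (t k) \<le> q k * B"
        using B(2) q_nonneg by (intro mult_left_mono) auto
      finally show ?case using elim[rule_format, of "y k"] g_le[of k] by (simp add: algebra_simps)
    qed
  qed (use p_pos p_le p_div in auto)
  then have "y \<longlonglongrightarrow> 0" by (simp add: tendsto_norm_zero_iff)
  from tendsto_add[OF this t_lim] show ?thesis by (simp add: y_def)
qed

section \<open>Series of independent random variables\<close>

lemma integrable_mult_square:
  fixes f g :: "'a \<Rightarrow> real" and M :: "'a measure"
  assumes [measurable]: "f \<in> borel_measurable M" "g \<in> borel_measurable M"
    and "integrable M (\<lambda>\<omega>. (f \<omega>)\<^sup>2)" "integrable M (\<lambda>\<omega>. (g \<omega>)\<^sup>2)"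
  shows "integrable M (\<lambda>\<omega>. f \<omega> * g \<omega>)"
proof (rule Bochner_Integration.integrable_bound)
  show "integrable M (\<lambda>\<omega>. (f \<omega>)\<^sup>2 + (g \<omega>)\<^sup>2)" using assms by simp
  show "AE \<omega> in M. norm (f \<omega> * g \<omega>) \<le> norm ((f \<omega>)\<^sup>2 + (g \<omega>)\<^sup>2)"
  proof (rule AE_I2)
    fix \<omega>
    have "2 * (\<bar>f \<omega>\<bar> * \<bar>g \<omega>\<bar>) \<le> (f \<omega>)\<^sup>2 + (g \<omega>)\<^sup>2"
      using zero_le_power2[of "\<bar>f \<omega>\<bar> - \<bar>g \<omega>\<bar>"] by (simp add: power2_diff)
    moreover have "0 \<le> \<bar>f \<omega>\<bar> * \<bar>g \<omega>\<bar>" by simp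
    ultimately have "\<bar>f \<omega>\<bar> * \<bar>g \<omega>\<bar> \<le> (f \<omega>)\<^sup>2 + (g \<omega>)\<^sup>2" by linarith
    then show "norm (f \<omega> * g \<omega>) \<le> norm ((f \<omega>)\<^sup>2 + (g \<omega>)\<^sup>2)" by (simp add: abs_mult)
  qed
qed simp

lemma integrable_square_sum:
  fixes X :: "'i \<Rightarrow> 'a \<Rightarrow> real" and M :: "'a measure"
  assumes "finite A" "\<And>k. k \<in> A \<Longrightarrow> X k \<in> borel_measurable M" "\<And>k. k \<in> A \<Longrightarrow> integrable M (\<lambda>\<omega>. (X k \<omega>)\<^sup>2)"
  shows "integrable M (\<lambda>\<omega>. (\<Sum>k\<in>A. X k \<omega>)\<^sup>2)"
  unfolding power2_eq_square sum_product
  using assms by (intro Bochner_Integration.integrable_sum integrable_mult_square) (auto simp: power2_eq_square)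

lemma AE_summable_if_summable_integral:
  fixes f :: "nat \<Rightarrow> 'a \<Rightarrow> real" and M :: "'a measure"
  assumes int: "\<And>k. integrable M (f k)" and nonneg: "\<And>k \<omega>. 0 \<le> f k \<omega>"
    and sum: "summable (\<lambda>k. integral\<^sup>L M (f k))"
  shows "AE \<omega> in M. summable (\<lambda>k. f k \<omega>)"
proof -
  have [measurable]: "f k \<in> borel_measurable M" for k using int by auto
  have "(\<integral>\<^sup>+\<omega>. (\<Sum>k. ennreal (f k \<omega>)) \<partial>M) = (\<Sum>k. \<integral>\<^sup>+\<omega>. ennreal (f k \<omega>) \<partial>M)"
    by (rule nn_integral_suminf) simp
  also have "\<dots> = (\<Sum>k. ennreal (integral\<^sup>L M (f k)))"
    using int nonneg by (simp add: nn_integral_eq_integral)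
  also have "\<dots> \<noteq> \<infinity>"
    using sum nonneg by (simp add: suminf_ennreal2)
  finally have "AE \<omega> in M. (\<Sum>k. ennreal (f k \<omega>)) \<noteq> \<infinity>"
    by (intro nn_integral_noteq_infinite) auto
  then show ?thesis
    by eventually_elim (use nonneg in \<open>auto intro: summable_suminf_not_top\<close>)
qed

context prob_space begin

text \<open>This serves time shifts of a sequence and the selection of one agent's noises.
  Injectivity lets events be carried to the image indices and keeps the product of probabilities
  unchanged.\<close>

lemma indep_vars_reindex_inj:
  assumes ind: "indep_vars M' X I" and f: "inj_on f J" "f ` J \<subseteq> I"
  shows "indep_vars (\<lambda>j. M' (f j)) (\<lambda>j. X (f j)) J"
  unfolding indep_vars_def2
proof
  show "\<forall>j\<in>J. random_variable (M' (f j)) (X (f j))"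
    using ind f(2) by (auto simp: indep_vars_def2)
  let ?F = "\<lambda>i. {X i -` A \<inter> space M |A. A \<in> sets (M' i)}"
  have F: "indep_sets ?F I" using ind by (simp add: indep_vars_def2)
  show "indep_sets (\<lambda>j. ?F (f j)) J"
  proof (rule indep_setsI)
    show "?F (f j) \<subseteq> events" if "j \<in> J" for j
      using F f(2) that unfolding indep_sets_def by blast
    fix A K assume K: "K \<noteq> {}" "K \<subseteq> J" "finite K" and A: "\<forall>j\<in>K. A j \<in> ?F (f j)"
    have inj: "inj_on f K" using f(1) K(2) inj_on_subset by blast
    define B where "B = (\<lambda>i. A (inv_into K f i))"
    have B: "B (f j) = A j" if "j \<in> K" for j
      unfolding B_def using inv_into_f_f[OF inj that] by simp
    have "prob (\<Inter>i\<in>f ` K. B i) = (\<Prod>i\<in>f ` K. prob (B i))"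
      using K f(2) A B by (intro indep_setsD[OF F]) auto
    moreover have "(\<Inter>i\<in>f ` K. B i) = (\<Inter>j\<in>K. A j)" using B by auto
    moreover have "(\<Prod>i\<in>f ` K. prob (B i)) = (\<Prod>j\<in>K. prob (A j))"
      by (simp add: prod.reindex[OF inj] B)
    ultimately show "prob (\<Inter>j\<in>K. A j) = (\<Prod>j\<in>K. prob (A j))" by simp
  qed
qed

text \<open>\<open>h\<close> sees only indices below \<open>k\<close>, so for
  \<open>k \<le> l\<close> its argument and \<open>X l\<close> use disjoint index sets. The
  expectation factors, and the second factor is centred.\<close>

lemma expectation_past_mult_eq_0:
  fixes X :: "nat \<Rightarrow> 'a \<Rightarrow> real" and h :: "(nat \<Rightarrow> real) \<Rightarrow> real"
  assumes ind: "indep_vars (\<lambda>_. borel) X UNIV"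
    and h: "h \<in> borel_measurable (PiM {..<k} (\<lambda>_. borel))" and "k \<le> l"
    and int: "integrable M (\<lambda>\<omega>. h (restrict (\<lambda>i. X i \<omega>) {..<k}))" "integrable M (X l)"
    and mean: "expectation (X l) = 0"
  shows "expectation (\<lambda>\<omega>. h (restrict (\<lambda>i. X i \<omega>) {..<k}) * X l \<omega>) = 0"
proof -
  have "indep_var borel (h \<circ> (\<lambda>\<omega>. restrict (\<lambda>i. X i \<omega>) {..<k})) borel ((\<lambda>f. f l) \<circ> (\<lambda>\<omega>. restrict (\<lambda>i. X i \<omega>) {l}))"
    using \<open>k \<le> l\<close> by (intro indep_var_compose[OF indep_var_restrict[OF ind]] h) auto
  then have "indep_var borel (\<lambda>\<omega>. h (restrict (\<lambda>i. X i \<omega>) {..<k})) borel (X l)"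
    by (simp add: comp_def)
  from indep_var_lebesgue_integral[OF this int] mean show ?thesis by simp
qed

text \<open>The event is split according to the first time the partial sums leave \<open>(-a, a)\<close>;
  the part of the sum after that time is uncorrelated with everything before it.\<close>

lemma kolmogorov_maximal_inequality:
  fixes X :: "nat \<Rightarrow> 'a \<Rightarrow> real"
  assumes ind: "indep_vars (\<lambda>_. borel) X UNIV"
    and sq: "\<And>k. integrable M (\<lambda>\<omega>. (X k \<omega>)\<^sup>2)"
    and mean: "\<And>k. expectation (X k) = 0"
    and "0 < a"
  shows "prob {\<omega>\<in>space M. \<exists>k\<le>n. a \<le> \<bar>\<Sum>i<k. X i \<omega>\<bar>} \<le> (\<Sum>k<n. expectation (\<lambda>\<omega>. (X k \<omega>)\<^sup>2)) / a\<^sup>2"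
proof -
  have Xm[measurable]: "X k \<in> borel_measurable M" for k
    using ind by (auto simp: indep_vars_def)
  have Xi: "integrable M (X k)" for k
    by (rule square_integrable_imp_integrable[OF Xm sq])
  define S where "S k \<omega> = (\<Sum>i<k. X i \<omega>)" for k \<omega>
  have Sm[measurable]: "S k \<in> borel_measurable M" for k unfolding S_def by measurable
  have Ssq: "integrable M (\<lambda>\<omega>. (S k \<omega>)\<^sup>2)" for k
    unfolding S_def by (intro integrable_square_sum sq) auto
  \<comment> \<open>The value \<open>S k\<close> if \<open>k\<close> is the first exit time and 0
    otherwise, written twice: \<open>h\<close> as a function of the first \<open>k\<close>
    coordinates, as independence requires, and \<open>H\<close> on the probability space.\<close>
  define h where "h k y = (let s = (\<lambda>j. \<Sum>i<j. y i) in if a \<le> \<bar>s k\<bar> \<and> (\<forall>j\<in>{..<k}. \<bar>s j\<bar> < a) then s k else 0)"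
    for k :: nat and y :: "nat \<Rightarrow> real"
  define H where "H k \<omega> = (if a \<le> \<bar>S k \<omega>\<bar> \<and> (\<forall>j\<in>{..<k}. \<bar>S j \<omega>\<bar> < a) then S k \<omega> else 0)" for k \<omega>
  have hH: "h k (restrict (\<lambda>i. X i \<omega>) {..<k}) = H k \<omega>" for k \<omega>
  proof -
    have "(\<Sum>i<j. restrict (\<lambda>i. X i \<omega>) {..<k} i) = S j \<omega>" if "j \<le> k" for j
      unfolding S_def using that by (intro sum.cong) auto
    then show ?thesis unfolding h_def H_def Let_def by (auto intro: less_imp_le)
  qed
  have hm: "h k \<in> borel_measurable (PiM {..<k} (\<lambda>_. borel))" for k
  proof -
    let ?P = "PiM {..<k} (\<lambda>_. borel :: real measure)"
    have s: "(\<lambda>y. \<Sum>i<j. y i) \<in> borel_measurable ?P" if "j \<le> k" for j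
      using that by (intro borel_measurable_sum measurable_component_singleton) auto
    note [measurable] = s[OF order_refl]
    have "Measurable.pred ?P (\<lambda>y. \<forall>j\<in>{..<k}. \<bar>\<Sum>i<j. y i\<bar> < a)"
    proof (rule pred_intros_finite(3))
      fix j assume "j \<in> {..<k}"
      then have [measurable]: "(\<lambda>y. \<Sum>i<j. y i) \<in> borel_measurable ?P" by (intro s) simp
      show "Measurable.pred ?P (\<lambda>y. \<bar>\<Sum>i<j. y i\<bar> < a)" by measurable
    qed simp
    note [measurable] = this
    show ?thesis unfolding h_def Let_def by measurable
  qed
  have [measurable]: "H k \<in> borel_measurable M" for k unfolding H_def by measurable
  have Hsq: "integrable M (\<lambda>\<omega>. (H k \<omega>)\<^sup>2)" for k
    by (rule Bochner_Integration.integrable_bound[OF Ssq[of k]]) (auto simp: H_def)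
  have Hi: "integrable M (H k)" for k
    by (rule square_integrable_imp_integrable[OF _ Hsq]) simp
  have HX: "expectation (\<lambda>\<omega>. H k \<omega> * X l \<omega>) = 0" if "k \<le> l" for k l
    using expectation_past_mult_eq_0[OF ind hm that, unfolded hH, OF Hi Xi mean] .
  have HXi: "integrable M (\<lambda>\<omega>. H k \<omega> * X l \<omega>)" for k l
    by (intro integrable_mult_square Hsq sq) auto
  have XX: "expectation (\<lambda>\<omega>. X k \<omega> * X l \<omega>) = 0" if "k < l" for k l
    using expectation_past_mult_eq_0[OF ind, of "\<lambda>y. y k" "Suc k" l] that Xi mean by simp
  have XXi: "integrable M (\<lambda>\<omega>. X k \<omega> * X l \<omega>)" for k l
    by (intro integrable_mult_square sq) auto
  have ES: "expectation (\<lambda>\<omega>. (S n \<omega>)\<^sup>2) = (\<Sum>k<n. expectation (\<lambda>\<omega>. (X k \<omega>)\<^sup>2))"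
  proof -
    have "expectation (\<lambda>\<omega>. (S n \<omega>)\<^sup>2) = (\<Sum>k<n. \<Sum>l<n. expectation (\<lambda>\<omega>. X k \<omega> * X l \<omega>))"
      unfolding S_def power2_eq_square sum_product
      by (simp add: Bochner_Integration.integral_sum Bochner_Integration.integrable_sum XXi)
    also have "\<dots> = (\<Sum>k<n. \<Sum>l<n. if l = k then expectation (\<lambda>\<omega>. (X k \<omega>)\<^sup>2) else 0)"
    proof (intro sum.cong refl)
      fix k l :: nat
      show "expectation (\<lambda>\<omega>. X k \<omega> * X l \<omega>) = (if l = k then expectation (\<lambda>\<omega>. (X k \<omega>)\<^sup>2) else 0)"
        using XX[of k l] XX[of l k] by (cases k l rule: linorder_cases) (auto simp: power2_eq_square mult.commute)
    qed
    also have "\<dots> = (\<Sum>k<n. expectation (\<lambda>\<omega>. (X k \<omega>)\<^sup>2))" by simp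
    finally show ?thesis .
  qed
  define E where "E = {\<omega>\<in>space M. \<exists>k\<le>n. a \<le> \<bar>S k \<omega>\<bar>}"
  have [measurable]: "E \<in> sets M" unfolding E_def by measurable
  \<comment> \<open>At first exit time m at most \<open>n\<close> only \<open>H m\<close> survives,
    and \<open>R\<close> becomes the cross term 2 S(m) (S(n) - S(m)) of the square of S(n). The
    inner sum starts at \<open>k\<close> because \<open>S k\<close> stops at index
    \<open>k - 1\<close>.\<close>
  define R where "R \<omega> = 2 * (\<Sum>k\<le>n. \<Sum>l=k..<n. H k \<omega> * X l \<omega>)" for \<omega>
  have Ri: "integrable M R"
    unfolding R_def by (intro integrable_mult_right Bochner_Integration.integrable_sum HXi)
  have ER: "expectation R = 0"
    unfolding R_def by (simp add: Bochner_Integration.integral_sum Bochner_Integration.integrable_sum HXi HX)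
  have pointwise: "a\<^sup>2 * indicator E \<omega> + R \<omega> \<le> (S n \<omega>)\<^sup>2" if "\<omega> \<in> space M" for \<omega>
  proof (cases "\<exists>k\<le>n. a \<le> \<bar>S k \<omega>\<bar>")
    case True
    define m where "m = (LEAST k. a \<le> \<bar>S k \<omega>\<bar>)"
    have m1: "a \<le> \<bar>S m \<omega>\<bar>" unfolding m_def using True by (metis LeastI)
    have m2: "\<bar>S j \<omega>\<bar> < a" if "j < m" for j
      using not_less_Least[of j] that unfolding m_def by fastforce
    have m3: "m \<le> n" using True unfolding m_def by (meson Least_le order_trans)
    have Hk: "H k \<omega> = (if k = m then S m \<omega> else 0)" for k
    proof (cases k m rule: linorder_cases)
      case greater
      then have "\<not> (\<forall>j\<in>{..<k}. \<bar>S j \<omega>\<bar> < a)" using m1 by (auto intro!: bexI[of _ m])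
      then show ?thesis using greater by (auto simp: H_def)
    next
      case less
      then show ?thesis using m2[of k] by (auto simp: H_def)
    qed (use m1 m2 in \<open>auto simp: H_def\<close>)
    have "R \<omega> = 2 * (\<Sum>k\<le>n. if k = m then S m \<omega> * (\<Sum>l=m..<n. X l \<omega>) else 0)"
      unfolding R_def by (intro arg_cong[where f="\<lambda>s. 2 * s"] sum.cong refl) (simp add: Hk sum_distrib_left)
    also have "\<dots> = 2 * (S m \<omega> * (\<Sum>l=m..<n. X l \<omega>))" using m3 by simp
    also have "(\<Sum>l=m..<n. X l \<omega>) = S n \<omega> - S m \<omega>"
      unfolding S_def using m3 by (simp add: lessThan_atLeast0 sum_diff_nat_ivl)
    finally have R: "R \<omega> = 2 * (S m \<omega> * (S n \<omega> - S m \<omega>))" .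
    have "(S n \<omega>)\<^sup>2 = (S m \<omega>)\<^sup>2 + R \<omega> + (S n \<omega> - S m \<omega>)\<^sup>2"
      unfolding R by (simp add: power2_eq_square algebra_simps)
    moreover have "a\<^sup>2 \<le> (S m \<omega>)\<^sup>2"
      using m1 \<open>0 < a\<close> power_mono[of a "\<bar>S m \<omega>\<bar>" 2] by simp
    moreover have "0 \<le> (S n \<omega> - S m \<omega>)\<^sup>2" by simp
    ultimately have "a\<^sup>2 + R \<omega> \<le> (S n \<omega>)\<^sup>2" by linarith
    then show ?thesis using True that by (simp add: E_def)
  next
    case False
    then have "H k \<omega> = 0" if "k \<le> n" for k using that by (auto simp: H_def)
    then have "R \<omega> = 0" by (simp add: R_def)
    then show ?thesis using False by (simp add: E_def)
  qed
  have Ei: "integrable M (\<lambda>\<omega>. a\<^sup>2 * indicator E \<omega> :: real)"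
    by (intro integrable_mult_right integrable_real_indicator) (auto simp: emeasure_eq_measure)
  have "a\<^sup>2 * prob E = expectation (\<lambda>\<omega>. a\<^sup>2 * indicator E \<omega> + R \<omega>)"
    using Ri ER by (simp add: Bochner_Integration.integral_add[OF Ei])
  also have "\<dots> \<le> expectation (\<lambda>\<omega>. (S n \<omega>)\<^sup>2)"
    using Ei Ri Ssq pointwise by (intro integral_mono) auto
  finally show ?thesis
    using \<open>0 < a\<close> unfolding ES by (simp add: E_def S_def field_simps)
qed

text \<open>Almost every path is Cauchy. For the sequence started at \<open>n\<close>, the maximal
  inequality bounds the probability of any excursion of size \<open>a\<close> by the tail of the
  variances over \<open>a\<^sup>2\<close>, which vanishes as \<open>n\<close> grows.\<close>

lemma AE_convergent_sum_real:
  fixes X :: "nat \<Rightarrow> 'a \<Rightarrow> real"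
  assumes ind: "indep_vars (\<lambda>_. borel) X UNIV"
    and sq: "\<And>k. integrable M (\<lambda>\<omega>. (X k \<omega>)\<^sup>2)"
    and mean: "\<And>k. expectation (X k) = 0"
    and var_sum: "summable (\<lambda>k. expectation (\<lambda>\<omega>. (X k \<omega>)\<^sup>2))"
  shows "AE \<omega> in M. convergent (\<lambda>n. \<Sum>k<n. X k \<omega>)"
proof -
  have Xm[measurable]: "X k \<in> borel_measurable M" for k
    using ind by (auto simp: indep_vars_def)
  define V where "V k = expectation (\<lambda>\<omega>. (X k \<omega>)\<^sup>2)" for k
  have V_nonneg: "0 \<le> V k" for k by (simp add: V_def)
  define E where "E a n = {\<omega>\<in>space M. \<exists>k. a \<le> \<bar>\<Sum>i<k. X (i + n) \<omega>\<bar>}" for a :: real and n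
  have [measurable]: "E a n \<in> sets M" for a n unfolding E_def by measurable
  have E_le: "prob (E a n) \<le> (\<Sum>k. V (k + n)) / a\<^sup>2" if "0 < a" for a n
  proof -
    \<comment> \<open>The maximal inequality has a finite horizon. The events \<open>F m\<close>
      increase to \<open>E a n\<close>, and their bound is uniform in \<open>m\<close>.\<close>
    define F where "F m = {\<omega>\<in>space M. \<exists>k\<le>m. a \<le> \<bar>\<Sum>i<k. X (i + n) \<omega>\<bar>}" for m
    have [measurable]: "F m \<in> sets M" for m unfolding F_def by measurable
    have ind': "indep_vars (\<lambda>_. borel) (\<lambda>k. X (k + n)) UNIV"
      by (rule indep_vars_reindex_inj[OF ind]) (auto simp: inj_on_def)
    have F_le: "prob (F m) \<le> (\<Sum>k. V (k + n)) / a\<^sup>2" for m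
    proof -
      have "prob (F m) \<le> (\<Sum>k<m. V (k + n)) / a\<^sup>2"
        unfolding F_def V_def by (rule kolmogorov_maximal_inequality[OF ind' sq mean that])
      also have "(\<Sum>k<m. V (k + n)) \<le> (\<Sum>k. V (k + n))"
        using var_sum V_nonneg unfolding V_def
        by (intro sum_le_suminf summable_ignore_initial_segment) auto
      finally show ?thesis using that by (simp add: divide_right_mono)
    qed
    have "(\<lambda>m. prob (F m)) \<longlonglongrightarrow> prob (\<Union>m. F m)"
      by (rule finite_Lim_measure_incseq) (auto simp: incseq_def F_def, meson order_trans)
    moreover have "(\<Union>m. F m) = E a n" by (auto simp: F_def E_def)
    ultimately show ?thesis using F_le by (auto intro: LIMSEQ_le_const2)
  qed
  have E_AE: "AE \<omega> in M. \<exists>n. \<omega> \<notin> E a n" if "0 < a" for a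
  proof -
    have "prob (\<Inter>n. E a n) \<le> 0"
    proof (rule LIMSEQ_le_const)
      have "(\<lambda>n. \<Sum>k. V (k + n)) \<longlonglongrightarrow> 0"
        using suminf_exist_split2 var_sum unfolding V_def .
      then show "(\<lambda>n. (\<Sum>k. V (k + n)) / a\<^sup>2) \<longlonglongrightarrow> 0"
        using tendsto_divide_zero by blast
      have "prob (\<Inter>n. E a n) \<le> (\<Sum>k. V (k + n)) / a\<^sup>2" for n
        using finite_measure_mono[of "\<Inter>n. E a n" "E a n"] E_le[OF that, of n] by fastforce
      then show "\<exists>N. \<forall>n\<ge>N. prob (\<Inter>n. E a n) \<le> (\<Sum>k. V (k + n)) / a\<^sup>2" by blast
    qed
    then have "prob (\<Inter>n. E a n) = 0" by (simp add: measure_le_0_iff)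
    then have "(\<Inter>n. E a n) \<in> null_sets M" by (simp add: emeasure_eq_measure null_sets_def)
    from AE_not_in[OF this] show ?thesis by eventually_elim auto
  qed
  \<comment> \<open>Countably many thresholds suffice, so one null set serves every
    \<epsilon>.\<close>
  have "AE \<omega> in M. \<forall>j::nat. \<exists>n. \<omega> \<notin> E (inverse (Suc j)) n"
    unfolding AE_all_countable by (intro allI E_AE) simp
  then show ?thesis using AE_space
  proof eventually_elim
    case (elim \<omega>)
    have "Cauchy (\<lambda>n. \<Sum>k<n. X k \<omega>)"
    proof (rule metric_CauchyI)
      fix \<epsilon> :: real assume "0 < \<epsilon>"
      then obtain j where j: "inverse (real (Suc j)) < \<epsilon> / 2" using reals_Archimedean[of "\<epsilon> / 2"] by auto
      obtain n where n: "\<omega> \<notin> E (inverse (Suc j)) n" using elim by blast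
      have near: "\<bar>(\<Sum>k<m. X k \<omega>) - (\<Sum>k<n. X k \<omega>)\<bar> < \<epsilon> / 2" if "m \<ge> n" for m
      proof -
        have "(\<Sum>k<m. X k \<omega>) - (\<Sum>k<n. X k \<omega>) = (\<Sum>k=n..<m. X k \<omega>)"
          using that by (simp add: lessThan_atLeast0 sum_diff_nat_ivl)
        also have "\<dots> = (\<Sum>i<m-n. X (i + n) \<omega>)"
          by (rule sum.reindex_bij_witness[of _ "\<lambda>k. k + n" "\<lambda>k. k - n"]) auto
        also have "\<bar>\<dots>\<bar> < inverse (Suc j)" using n elim by (auto simp: E_def not_le)
        finally show ?thesis using j by simp
      qed
      have "dist (\<Sum>k<m. X k \<omega>) (\<Sum>k<m'. X k \<omega>) < \<epsilon>" if "m \<ge> n" "m' \<ge> n" for m m'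
        using near[OF that(1)] near[OF that(2)] unfolding dist_real_def by linarith
      then show "\<exists>N. \<forall>m\<ge>N. \<forall>m'\<ge>N. dist (\<Sum>k<m. X k \<omega>) (\<Sum>k<m'. X k \<omega>) < \<epsilon>" by blast
    qed
    then show ?case by (simp add: Cauchy_convergent_iff)
  qed
qed

lemma AE_convergent_sum:
  fixes X :: "nat \<Rightarrow> 'a \<Rightarrow> 'b::euclidean_space"
  assumes ind: "indep_vars (\<lambda>_. borel) X UNIV"
    and sq: "\<And>k. integrable M (\<lambda>\<omega>. (norm (X k \<omega>))\<^sup>2)"
    and mean: "\<And>k b. b \<in> Basis \<Longrightarrow> expectation (\<lambda>\<omega>. X k \<omega> \<bullet> b) = 0"
    and var_sum: "summable (\<lambda>k. expectation (\<lambda>\<omega>. (norm (X k \<omega>))\<^sup>2))"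
  shows "AE \<omega> in M. convergent (\<lambda>n. \<Sum>k<n. X k \<omega>)"
proof -
  have Xm[measurable]: "X k \<in> borel_measurable M" for k
    using ind by (auto simp: indep_vars_def)
  have "AE \<omega> in M. convergent (\<lambda>n. \<Sum>k<n. X k \<omega> \<bullet> b)" if b: "b \<in> Basis" for b
  proof (rule AE_convergent_sum_real)
    show "indep_vars (\<lambda>_. borel) (\<lambda>k \<omega>. X k \<omega> \<bullet> b) UNIV"
      by (rule indep_vars_compose2[OF ind]) simp
    have le: "(X k \<omega> \<bullet> b)\<^sup>2 \<le> (norm (X k \<omega>))\<^sup>2" for k \<omega>
      using Basis_le_norm[OF b, of "X k \<omega>"] by (metis abs_ge_zero power2_abs power_mono)
    show sqb: "integrable M (\<lambda>\<omega>. (X k \<omega> \<bullet> b)\<^sup>2)" for k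
      by (rule Bochner_Integration.integrable_bound[OF sq[of k]]) (auto simp: le)
    show "summable (\<lambda>k. expectation (\<lambda>\<omega>. (X k \<omega> \<bullet> b)\<^sup>2))"
      by (rule summable_comparison_test'[OF var_sum]) (auto intro!: integral_mono sq sqb le)
  qed (rule mean[OF b])
  then have "AE \<omega> in M. \<forall>b\<in>Basis. convergent (\<lambda>n. \<Sum>k<n. X k \<omega> \<bullet> b)"
    by (intro AE_finite_allI) auto
  then show ?thesis
  proof eventually_elim
    case (elim \<omega>)
    have "\<forall>b\<in>Basis. \<exists>l. (\<lambda>n. (\<Sum>k<n. X k \<omega>) \<bullet> b) \<longlonglongrightarrow> l"
      using elim unfolding convergent_def by (simp add: inner_sum_left)
    then obtain l where l: "\<And>b. b \<in> Basis \<Longrightarrow> (\<lambda>n. (\<Sum>k<n. X k \<omega>) \<bullet> b) \<longlonglongrightarrow> l b"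
      by metis
    have "(\<lambda>n. \<Sum>k<n. X k \<omega>) \<longlonglongrightarrow> (\<Sum>b\<in>Basis. l b *\<^sub>R b)"
      by (subst euclidean_representation[symmetric]) (intro tendsto_sum tendsto_scaleR l tendsto_const)
    then show ?case by (rule convergentI)
  qed
qed

section \<open>Second moments of linear recursions\<close>

text \<open>\<open>V k\<close> is affine in the noises before time \<open>k\<close>, hence
  uncorrelated with \<open>N k\<close>, and the cross term of the squared norm vanishes.
  Uncorrelatedness of the noises is the form assumed because it passes directly from the agents to
  linear images of the stacked noise.\<close>

lemma linear_recursion_second_moment:
  fixes V N :: "nat \<Rightarrow> 'a \<Rightarrow> 'b::euclidean_space" and T :: "nat \<Rightarrow> 'b \<Rightarrow> 'b" and g :: "nat \<Rightarrow> 'b"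
  assumes init: "\<And>\<omega>. \<omega> \<in> space M \<Longrightarrow> V 0 \<omega> = v0"
    and rec: "\<And>k \<omega>. \<omega> \<in> space M \<Longrightarrow> V (Suc k) \<omega> = T k (V k \<omega>) + g k + N k \<omega>"
    and T_lin: "\<And>k. linear (T k)"
    and N_meas[measurable]: "\<And>k. N k \<in> borel_measurable M"
    and N_sq: "\<And>k. integrable M (\<lambda>\<omega>. (norm (N k \<omega>))\<^sup>2)"
    and N_mean: "\<And>k a. expectation (\<lambda>\<omega>. N k \<omega> \<bullet> a) = 0"
    and N_uncorr: "\<And>k l a b. k < l \<Longrightarrow> expectation (\<lambda>\<omega>. (N k \<omega> \<bullet> a) * (N l \<omega> \<bullet> b)) = 0"
  shows "V k \<in> borel_measurable M"
    and "integrable M (\<lambda>\<omega>. (norm (V k \<omega>))\<^sup>2)"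
    and "expectation (\<lambda>\<omega>. (norm (V (Suc k) \<omega>))\<^sup>2)
      = expectation (\<lambda>\<omega>. (norm (T k (V k \<omega>) + g k))\<^sup>2) + expectation (\<lambda>\<omega>. (norm (N k \<omega>))\<^sup>2)"
proof -
  have T_meas[measurable]: "T k \<in> borel_measurable borel" for k
    by (intro borel_measurable_continuous_onI linear_continuous_on linear_conv_bounded_linear[THEN iffD1] T_lin)
  have inner_sq: "integrable M (\<lambda>\<omega>. (f \<omega> \<bullet> a)\<^sup>2)"
    if [measurable]: "f \<in> borel_measurable M" and "integrable M (\<lambda>\<omega>. (norm (f \<omega>))\<^sup>2)"
    for f :: "'a \<Rightarrow> 'b" and a
  proof (rule Bochner_Integration.integrable_bound)
    show "integrable M (\<lambda>\<omega>. (norm a)\<^sup>2 * (norm (f \<omega>))\<^sup>2)" using that by simp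
    have "(f \<omega> \<bullet> a)\<^sup>2 \<le> (norm a)\<^sup>2 * (norm (f \<omega>))\<^sup>2" for \<omega>
      using Cauchy_Schwarz_ineq[of "f \<omega>" a] by (simp add: power2_norm_eq_inner mult.commute)
    then show "AE \<omega> in M. norm ((f \<omega> \<bullet> a)\<^sup>2) \<le> norm ((norm a)\<^sup>2 * (norm (f \<omega>))\<^sup>2)" by simp
  qed simp
  have NN: "integrable M (\<lambda>\<omega>. N k \<omega> \<bullet> a)" for k a
    by (rule square_integrable_imp_integrable) (auto intro: inner_sq N_sq)
  have inner_mult: "integrable M (\<lambda>\<omega>. (f \<omega> \<bullet> a) * (h \<omega> \<bullet> b))"
    if [measurable]: "f \<in> borel_measurable M" "h \<in> borel_measurable M"
      and "integrable M (\<lambda>\<omega>. (norm (f \<omega>))\<^sup>2)" "integrable M (\<lambda>\<omega>. (norm (h \<omega>))\<^sup>2)"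
    for f h :: "'a \<Rightarrow> 'b" and a b
    by (intro integrable_mult_square inner_sq that) auto
  have norm_sq_eq: "(norm w)\<^sup>2 = (\<Sum>b\<in>Basis. (w \<bullet> b)\<^sup>2)" for w :: 'b
    unfolding power2_norm_eq_inner unfolding power2_eq_square by (rule euclidean_inner)
  \<comment> \<open>All directions \<open>a\<close> are needed because each step replaces
    \<open>a\<close> by its image under the adjoint of \<open>T k\<close>; all times
    \<open>l\<close> from \<open>k\<close> on are needed because the step uses the claim at the same
    \<open>l\<close>.\<close>
  have inv: "V k \<in> borel_measurable M \<and> integrable M (\<lambda>\<omega>. (norm (V k \<omega>))\<^sup>2)
    \<and> (\<forall>l\<ge>k. \<forall>a b. expectation (\<lambda>\<omega>. (V k \<omega> \<bullet> a) * (N l \<omega> \<bullet> b)) = 0)" for k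
  proof (induction k)
    case 0
    have "V 0 \<in> borel_measurable M"
      by (subst measurable_cong[OF init]) auto
    moreover have "integrable M (\<lambda>\<omega>. (norm (V 0 \<omega>))\<^sup>2)"
      by (subst Bochner_Integration.integrable_cong[OF refl, of M _ "\<lambda>_. (norm v0)\<^sup>2"]) (auto simp: init)
    moreover have "expectation (\<lambda>\<omega>. (V 0 \<omega> \<bullet> a) * (N l \<omega> \<bullet> b)) = 0" for l a b
    proof -
      have "expectation (\<lambda>\<omega>. (V 0 \<omega> \<bullet> a) * (N l \<omega> \<bullet> b)) = expectation (\<lambda>\<omega>. (v0 \<bullet> a) * (N l \<omega> \<bullet> b))"
        by (rule Bochner_Integration.integral_cong) (auto simp: init)
      then show ?thesis by (simp add: N_mean)
    qed
    ultimately show ?case by blast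
  next
    case (Suc k)
    then have [measurable]: "V k \<in> borel_measurable M"
      and Vsq: "integrable M (\<lambda>\<omega>. (norm (V k \<omega>))\<^sup>2)"
      and VN: "\<And>l a b. l \<ge> k \<Longrightarrow> expectation (\<lambda>\<omega>. (V k \<omega> \<bullet> a) * (N l \<omega> \<bullet> b)) = 0" by auto
    have "V (Suc k) \<in> borel_measurable M"
      by (subst measurable_cong[OF rec]) auto
    moreover have exp_eq: "V (Suc k) \<omega> \<bullet> a = V k \<omega> \<bullet> adjoint (T k) a + g k \<bullet> a + N k \<omega> \<bullet> a"
      if "\<omega> \<in> space M" for \<omega> a
      by (simp add: rec[OF that] inner_add_left adjoint_works[OF T_lin])
    moreover have "integrable M (\<lambda>\<omega>. (norm (V (Suc k) \<omega>))\<^sup>2)"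
    proof -
      have "integrable M (\<lambda>\<omega>. (V (Suc k) \<omega> \<bullet> b)\<^sup>2)" for b
      proof (subst Bochner_Integration.integrable_cong[OF refl])
        show "(V (Suc k) \<omega> \<bullet> b)\<^sup>2 = (V k \<omega> \<bullet> adjoint (T k) b + g k \<bullet> b + N k \<omega> \<bullet> b)\<^sup>2"
          if "\<omega> \<in> space M" for \<omega> by (simp add: exp_eq that)
        have "integrable M (\<lambda>\<omega>. V k \<omega> \<bullet> adjoint (T k) b)"
          by (rule square_integrable_imp_integrable) (auto intro: inner_sq Vsq)
        then show "integrable M (\<lambda>\<omega>. (V k \<omega> \<bullet> adjoint (T k) b + g k \<bullet> b + N k \<omega> \<bullet> b)\<^sup>2)"
          unfolding power2_eq_square ring_distribs using NN
          by (intro Bochner_Integration.integrable_add integrable_mult_left integrable_mult_right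
              inner_mult Vsq N_sq) auto
      qed
      then show ?thesis unfolding norm_sq_eq by simp
    qed
    moreover have "expectation (\<lambda>\<omega>. (V (Suc k) \<omega> \<bullet> a) * (N l \<omega> \<bullet> b)) = 0" if "l \<ge> Suc k" for l a b
    proof -
      have "expectation (\<lambda>\<omega>. (V (Suc k) \<omega> \<bullet> a) * (N l \<omega> \<bullet> b))
        = expectation (\<lambda>\<omega>. (V k \<omega> \<bullet> adjoint (T k) a) * (N l \<omega> \<bullet> b)
            + (g k \<bullet> a) * (N l \<omega> \<bullet> b) + (N k \<omega> \<bullet> a) * (N l \<omega> \<bullet> b))"
        by (rule Bochner_Integration.integral_cong) (auto simp: exp_eq algebra_simps)
      then show ?thesis
        using that by (simp add: inner_mult Vsq N_sq NN VN N_mean N_uncorr)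
    qed
    ultimately show ?case by blast
  qed
  show V_meas[measurable]: "V k \<in> borel_measurable M"
    and V_sq: "integrable M (\<lambda>\<omega>. (norm (V k \<omega>))\<^sup>2)" using inv by auto
  define W where "W \<omega> = T k (V k \<omega>) + g k" for \<omega>
  have [measurable]: "W \<in> borel_measurable M" unfolding W_def by simp
  obtain B where B: "\<And>w. norm (T k w) \<le> B * norm w"
    using linear_bounded[OF T_lin] by blast
  have W_sq: "integrable M (\<lambda>\<omega>. (norm (W \<omega>))\<^sup>2)"
  proof (rule Bochner_Integration.integrable_bound)
    show "integrable M (\<lambda>\<omega>. 2 * B\<^sup>2 * (norm (V k \<omega>))\<^sup>2 + 2 * (norm (g k))\<^sup>2)"
      using V_sq by simp
    have "(norm (W \<omega>))\<^sup>2 \<le> 2 * B\<^sup>2 * (norm (V k \<omega>))\<^sup>2 + 2 * (norm (g k))\<^sup>2" for \<omega>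
    proof -
      have "norm (W \<omega>) \<le> B * norm (V k \<omega>) + norm (g k)"
        unfolding W_def using B[of "V k \<omega>"] norm_triangle_ineq[of "T k (V k \<omega>)" "g k"] by linarith
      then have "(norm (W \<omega>))\<^sup>2 \<le> (B * norm (V k \<omega>) + norm (g k))\<^sup>2" by (intro power_mono) auto
      also have "\<dots> \<le> 2 * B\<^sup>2 * (norm (V k \<omega>))\<^sup>2 + 2 * (norm (g k))\<^sup>2"
        using zero_le_power2[of "B * norm (V k \<omega>) - norm (g k)"]
        by (simp add: power2_sum power2_diff power_mult_distrib)
      finally show ?thesis .
    qed
    then show "AE \<omega> in M. norm ((norm (W \<omega>))\<^sup>2) \<le> norm (2 * B\<^sup>2 * (norm (V k \<omega>))\<^sup>2 + 2 * (norm (g k))\<^sup>2)"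
      by simp
  qed simp
  have WN_int: "integrable M (\<lambda>\<omega>. (W \<omega> \<bullet> b) * (N k \<omega> \<bullet> b))" for b
    by (intro inner_mult W_sq N_sq) auto
  have WN: "expectation (\<lambda>\<omega>. (W \<omega> \<bullet> b) * (N k \<omega> \<bullet> b)) = 0" for b
  proof -
    have "expectation (\<lambda>\<omega>. (W \<omega> \<bullet> b) * (N k \<omega> \<bullet> b))
      = expectation (\<lambda>\<omega>. (V k \<omega> \<bullet> adjoint (T k) b) * (N k \<omega> \<bullet> b) + (g k \<bullet> b) * (N k \<omega> \<bullet> b))"
      by (rule Bochner_Integration.integral_cong)
        (auto simp: W_def inner_add_left adjoint_works[OF T_lin] algebra_simps)
    then show ?thesis using inv[of k]
      by (simp add: inner_mult V_sq N_sq NN N_mean)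
  qed
  have "expectation (\<lambda>\<omega>. (norm (V (Suc k) \<omega>))\<^sup>2)
    = expectation (\<lambda>\<omega>. (norm (W \<omega>))\<^sup>2 + (norm (N k \<omega>))\<^sup>2 + 2 * (\<Sum>b\<in>Basis. (W \<omega> \<bullet> b) * (N k \<omega> \<bullet> b)))"
  proof (rule Bochner_Integration.integral_cong[OF refl])
    fix \<omega> assume "\<omega> \<in> space M"
    then have "V (Suc k) \<omega> = W \<omega> + N k \<omega>" by (simp add: rec W_def)
    then show "(norm (V (Suc k) \<omega>))\<^sup>2
      = (norm (W \<omega>))\<^sup>2 + (norm (N k \<omega>))\<^sup>2 + 2 * (\<Sum>b\<in>Basis. (W \<omega> \<bullet> b) * (N k \<omega> \<bullet> b))"
      by (simp add: power2_norm_eq_inner inner_add_left inner_add_right inner_commute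
          euclidean_inner[of "W \<omega>" "N k \<omega>"])
  qed
  also have "\<dots> = expectation (\<lambda>\<omega>. (norm (W \<omega>))\<^sup>2) + expectation (\<lambda>\<omega>. (norm (N k \<omega>))\<^sup>2)"
    by (simp add: W_sq N_sq WN_int WN Bochner_Integration.integral_sum Bochner_Integration.integrable_sum)
  finally show "expectation (\<lambda>\<omega>. (norm (V (Suc k) \<omega>))\<^sup>2)
      = expectation (\<lambda>\<omega>. (norm (T k (V k \<omega>) + g k))\<^sup>2) + expectation (\<lambda>\<omega>. (norm (N k \<omega>))\<^sup>2)"
    unfolding W_def .
qed

text \<open>For \<open>u k\<close> the second moment of \<open>V k\<close>, the convex bound leaves
  the full decrease \<open>p k * u k\<close>, and the drift costs only
  \<open>(c k)\<^sup>2 / p k\<close>. Telescoping then makes the expectations of the claimed terms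
  summable.\<close>

lemma AE_summable_contracting_recursion:
  fixes V N :: "nat \<Rightarrow> 'a \<Rightarrow> 'b::euclidean_space" and T :: "nat \<Rightarrow> 'b \<Rightarrow> 'b" and g :: "nat \<Rightarrow> 'b"
  assumes init: "\<And>\<omega>. \<omega> \<in> space M \<Longrightarrow> V 0 \<omega> = v0"
    and rec: "\<And>k \<omega>. \<omega> \<in> space M \<Longrightarrow> V (Suc k) \<omega> = T k (V k \<omega>) + g k + N k \<omega>"
    and T_lin: "\<And>k. linear (T k)"
    and N_meas: "\<And>k. N k \<in> borel_measurable M"
    and N_sq: "\<And>k. integrable M (\<lambda>\<omega>. (norm (N k \<omega>))\<^sup>2)"
    and N_mean: "\<And>k a. expectation (\<lambda>\<omega>. N k \<omega> \<bullet> a) = 0"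
    and N_uncorr: "\<And>k l a b. k < l \<Longrightarrow> expectation (\<lambda>\<omega>. (N k \<omega> \<bullet> a) * (N l \<omega> \<bullet> b)) = 0"
    and T_contr: "\<forall>\<^sub>F k in sequentially. \<forall>w. norm (T k w) \<le> (1 - p k) * norm w"
    and g_le: "\<And>k. norm (g k) \<le> c k"
    and p_pos: "\<And>k. 0 < p k" and p_le: "\<forall>\<^sub>F k in sequentially. p k \<le> 1"
    and c_sum: "summable (\<lambda>k. (c k)\<^sup>2 / p k)"
    and N_sum: "summable (\<lambda>k. expectation (\<lambda>\<omega>. (norm (N k \<omega>))\<^sup>2))"
  shows "AE \<omega> in M. summable (\<lambda>k. p k * (norm (V k \<omega>))\<^sup>2)"
proof (rule AE_summable_if_summable_integral)
  note mom = linear_recursion_second_moment[where V=V and N=N and T=T and g=g, OF init rec T_lin N_meas N_sq N_mean N_uncorr]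
  note V_meas[measurable] = mom(1) and V_sq = mom(2) and V_step = mom(3)
  show "integrable M (\<lambda>\<omega>. p k * (norm (V k \<omega>))\<^sup>2)" for k using V_sq by simp
  show "0 \<le> p k * (norm (V k \<omega>))\<^sup>2" for k \<omega> using p_pos[of k] by simp
  define u where "u k = expectation (\<lambda>\<omega>. (norm (V k \<omega>))\<^sup>2)" for k
  have "summable (\<lambda>k. p k * u k)"
  proof (rule summable_if_telescoping)
    show u0: "0 \<le> u k" for k by (simp add: u_def)
    then show "0 \<le> p k * u k" for k using p_pos[of k] by simp
    show "summable (\<lambda>k. (c k)\<^sup>2 / p k + expectation (\<lambda>\<omega>. (norm (N k \<omega>))\<^sup>2))"
      using c_sum N_sum by (rule summable_add)
    show "0 \<le> (c k)\<^sup>2 / p k + expectation (\<lambda>\<omega>. (norm (N k \<omega>))\<^sup>2)" for k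
      using p_pos[of k] by simp
    show "\<forall>\<^sub>F k in sequentially.
      u (Suc k) \<le> u k - p k * u k + ((c k)\<^sup>2 / p k + expectation (\<lambda>\<omega>. (norm (N k \<omega>))\<^sup>2))"
      using T_contr p_le
    proof eventually_elim
      case (elim k)
      have "expectation (\<lambda>\<omega>. (norm (T k (V k \<omega>) + g k))\<^sup>2)
        \<le> expectation (\<lambda>\<omega>. (1 - p k) * (norm (V k \<omega>))\<^sup>2 + (c k)\<^sup>2 / p k)"
      proof (rule integral_mono')
        show "integrable M (\<lambda>\<omega>. (1 - p k) * (norm (V k \<omega>))\<^sup>2 + (c k)\<^sup>2 / p k)"
          using V_sq by simp
        fix \<omega>
        have "norm (T k (V k \<omega>) + g k) \<le> (1 - p k) * norm (V k \<omega>) + c k"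
          using elim(1)[rule_format, of "V k \<omega>"] g_le[of k] norm_triangle_ineq[of "T k (V k \<omega>)" "g k"]
          by linarith
        then have "(norm (T k (V k \<omega>) + g k))\<^sup>2 \<le> ((1 - p k) * norm (V k \<omega>) + c k)\<^sup>2"
          by (intro power_mono) auto
        also have "\<dots> \<le> (1 - p k) * (norm (V k \<omega>))\<^sup>2 + (c k)\<^sup>2 / p k"
          by (intro convex_square_bound p_pos elim)
        finally show "(norm (T k (V k \<omega>) + g k))\<^sup>2 \<le> (1 - p k) * (norm (V k \<omega>))\<^sup>2 + (c k)\<^sup>2 / p k" .
        then show "0 \<le> (1 - p k) * (norm (V k \<omega>))\<^sup>2 + (c k)\<^sup>2 / p k"
          by (rule order_trans[rotated]) simp
      qed
      also have "\<dots> = (1 - p k) * u k + (c k)\<^sup>2 / p k"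
        using V_sq by (simp add: u_def prob_space)
      finally show ?case using V_step[of k] by (simp add: u_def algebra_simps)
    qed
  qed
  then show "summable (\<lambda>k. expectation (\<lambda>\<omega>. p k * (norm (V k \<omega>))\<^sup>2))"
    by (simp add: u_def)
qed

lemma indep_var_inner:
  fixes X :: "'i \<Rightarrow> 'a \<Rightarrow> 'b::euclidean_space"
  assumes ind: "indep_vars (\<lambda>_. borel) X I" and ij: "i \<in> I" "j \<in> I" "i \<noteq> j"
  shows "indep_var borel (\<lambda>\<omega>. X i \<omega> \<bullet> a) borel (\<lambda>\<omega>. X j \<omega> \<bullet> b)"
proof -
  have "indep_var borel ((\<lambda>f. f i \<bullet> a) \<circ> (\<lambda>\<omega>. restrict (\<lambda>i. X i \<omega>) {i}))
      borel ((\<lambda>f. f j \<bullet> b) \<circ> (\<lambda>\<omega>. restrict (\<lambda>i. X i \<omega>) {j}))"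
    using ij by (intro indep_var_compose[OF indep_var_restrict[OF ind]]) auto
  then show ?thesis by (simp add: comp_def)
qed

text \<open>The tower property: integrating the constant conditional moments gives the ordinary
  ones, the form in which the noise is used afterwards.\<close>

lemma moments_from_conditional_moments:
  fixes X :: "'a \<Rightarrow> real^'d" and Z :: "'a \<Rightarrow> real^'d"
  assumes X[measurable]: "X \<in> borel_measurable M" and Z[measurable]: "Z \<in> borel_measurable M"
    and mean: "AE \<omega> in M. vec_cond_exp M (gen_algebra M X borel) Z \<omega> = 0"
    and var: "AE \<omega> in M. nn_cond_exp M (gen_algebra M X borel) (\<lambda>\<omega>'. ennreal ((norm (Z \<omega>'))\<^sup>2)) \<omega> = ennreal (s\<^sup>2)"
  shows "integrable M (\<lambda>\<omega>. (norm (Z \<omega>))\<^sup>2)"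
    and "expectation (\<lambda>\<omega>. (norm (Z \<omega>))\<^sup>2) = s\<^sup>2"
    and "integrable M (\<lambda>\<omega>. Z \<omega> \<bullet> a)"
    and "expectation (\<lambda>\<omega>. Z \<omega> \<bullet> a) = 0"
proof -
  define F where "F = gen_algebra M X borel"
  have F: "subalgebra M F"
    unfolding F_def gen_algebra_def subalgebra_def
    using X by (auto simp: sets_vimage_algebra2 measurable_space)
  interpret finite_measure_subalgebra M F
    by unfold_locales (rule F)
  have "(\<integral>\<^sup>+\<omega>. ennreal ((norm (Z \<omega>))\<^sup>2) \<partial>M)
      = (\<integral>\<^sup>+\<omega>. nn_cond_exp M F (\<lambda>\<omega>'. ennreal ((norm (Z \<omega>'))\<^sup>2)) \<omega> \<partial>M)"
    using nn_cond_exp_intg[of "\<lambda>_. 1" "\<lambda>\<omega>'. ennreal ((norm (Z \<omega>'))\<^sup>2)"] by simp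
  also have "\<dots> = (\<integral>\<^sup>+\<omega>. ennreal (s\<^sup>2) \<partial>M)"
    by (rule nn_integral_cong_AE) (use var in \<open>simp add: F_def\<close>)
  also have "\<dots> = ennreal (s\<^sup>2)" by (simp add: emeasure_space_1)
  finally have nn: "(\<integral>\<^sup>+\<omega>. ennreal ((norm (Z \<omega>))\<^sup>2) \<partial>M) = ennreal (s\<^sup>2)" .
  \<comment> \<open>Integrability has to come from the nonnegative conditional expectation of the
    square, since the conditional mean determines the ordinary mean only for integrable
    variables.\<close>
  show sq: "integrable M (\<lambda>\<omega>. (norm (Z \<omega>))\<^sup>2)"
    by (rule integrableI_nonneg) (auto simp: nn)
  show "expectation (\<lambda>\<omega>. (norm (Z \<omega>))\<^sup>2) = s\<^sup>2"
    using nn sq by (simp add: integral_eq_nn_integral)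
  have "integrable M (\<lambda>\<omega>. norm (Z \<omega>))"
    by (rule square_integrable_imp_integrable[OF _ sq]) simp
  then have Zi: "integrable M Z" by (simp add: integrable_norm_iff)
  then show "integrable M (\<lambda>\<omega>. Z \<omega> \<bullet> a)" by simp
  have nth: "integrable M (\<lambda>\<omega>. Z \<omega> $ c)" for c
    using Zi integrable_bounded_linear[OF bounded_linear_vec_nth] by blast
  have "expectation (\<lambda>\<omega>. Z \<omega> $ c) = 0" for c
  proof -
    have "expectation (\<lambda>\<omega>. Z \<omega> $ c) = expectation (real_cond_exp M F (\<lambda>\<omega>. Z \<omega> $ c))"
      using real_cond_exp_int(2)[OF nth] by simp
    also have "\<dots> = expectation (\<lambda>_. 0)"
    proof (rule integral_cong_AE)
      show "AE \<omega> in M. real_cond_exp M F (\<lambda>\<omega>. Z \<omega> $ c) \<omega> = 0"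
        using mean by eventually_elim (simp add: vec_cond_exp_def F_def vec_eq_iff)
    qed auto
    finally show ?thesis by simp
  qed
  then show "expectation (\<lambda>\<omega>. Z \<omega> \<bullet> a) = 0"
    by (simp add: inner_vec_def nth)
qed

end

section \<open>Mixing and averaging\<close>

text \<open>The Kronecker product of \<open>A\<close> with the identity on the agents' state space.
  Stacking all agents in one Euclidean space turns the algorithm into a single linear
  recursion.\<close>

definition mix :: "real^'m^'m \<Rightarrow> real^'d^'m \<Rightarrow> real^'d^'m" where
  "mix A v = (\<chi> i. \<Sum>j\<in>UNIV. A $ i $ j *\<^sub>R v $ j)"

definition mean_state :: "real^'d^'m \<Rightarrow> real^'d" where
  "mean_state v = (1 / real CARD('m)) *\<^sub>R (\<Sum>i\<in>UNIV. v $ i)"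

definition centre :: "real^'d^'m \<Rightarrow> real^'d^'m" where
  "centre v = (\<chi> i. v $ i - mean_state v)"

lemma linear_mix: "linear (mix A)"
  by (rule linearI)
    (simp_all add: mix_def vec_eq_iff scaleR_right_distrib sum.distrib scaleR_sum_right sum_distrib_left algebra_simps)

lemma linear_mean_state: "linear mean_state"
  by (rule linearI)
    (simp_all add: mean_state_def sum.distrib scaleR_sum_right[symmetric] algebra_simps)

lemma linear_centre: "linear centre"
  by (rule linearI)
    (simp_all add: centre_def vec_eq_iff linear_add[OF linear_mean_state] linear_scale[OF linear_mean_state] algebra_simps)

text \<open>\<open>A\<close> acts separately on each coordinate of the states, and squared norms add
  over coordinates, so the operator norm of \<open>A\<close> carries over without a dimension
  factor.\<close>

lemma norm_mix_le:
  fixes A :: "real^'m^'m" and v :: "real^'d^'m"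
  shows "norm (mix A v) \<le> onorm ((*v) A) * norm v"
proof -
  have norm_sq: "(norm u)\<^sup>2 = (\<Sum>c\<in>UNIV. (norm (\<chi> i. u $ i $ c))\<^sup>2)" for u :: "real^'d^'m"
    unfolding power2_norm_eq_inner inner_vec_def by (simp add: sum.swap[of _ "UNIV::'d set"])
  have col: "(\<chi> i. mix A v $ i $ c) = A *v (\<chi> i. v $ i $ c)" for c
    by (simp add: mix_def vec_eq_iff matrix_vector_mult_def)
  have "(norm (mix A v))\<^sup>2 = (\<Sum>c\<in>UNIV. (norm (A *v (\<chi> i. v $ i $ c)))\<^sup>2)"
    unfolding norm_sq[of "mix A v"] col ..
  also have "\<dots> \<le> (\<Sum>c\<in>UNIV. (onorm ((*v) A) * norm (\<chi> i. v $ i $ c))\<^sup>2)"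
    by (intro sum_mono power_mono onorm) auto
  also have "\<dots> = (onorm ((*v) A) * norm v)\<^sup>2"
    by (simp add: power_mult_distrib norm_sq[of v] sum_distrib_left)
  finally show ?thesis
    by (rule power2_le_imp_le) (simp add: onorm_pos_le)
qed

lemma mean_state_mix:
  assumes "\<And>j. (\<Sum>i\<in>UNIV. L $ i $ j) = 0"
  shows "mean_state (mix L v) = 0"
proof -
  have "(\<Sum>i\<in>UNIV. mix L v $ i) = (\<Sum>j\<in>UNIV. (\<Sum>i\<in>UNIV. L $ i $ j) *\<^sub>R v $ j)"
    by (simp add: mix_def scaleR_sum_left) (rule sum.swap)
  then show ?thesis using assms by (simp add: mean_state_def)
qed

text \<open>A multiple of the all-ones matrix annihilates vectors of sum zero, and zero row sums
  make \<open>L\<close> blind to the subtracted average.\<close>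

lemma mix_deviation_matrix:
  fixes A L :: "real^'m^'m" and v :: "real^'d^'m"
  assumes row: "\<And>i. (\<Sum>j\<in>UNIV. L $ i $ j) = 0"
    and A: "\<And>i j. A $ i $ j = (if i = j then 1 else 0) + L $ i $ j - c"
  shows "mix A (centre v) = centre v + mix L v"
proof -
  have "mix A (centre v) $ i = centre v $ i + mix L v $ i" for i
  proof -
    have "(\<Sum>j\<in>UNIV. centre v $ j) = 0"
      by (simp add: centre_def mean_state_def sum_subtractf sum_constant_scaleR del: sum_constant)
    then have s0: "(\<Sum>j\<in>UNIV. c *\<^sub>R centre v $ j) = 0"
      by (simp only: scaleR_sum_right[symmetric]) simp
    have s1: "(\<Sum>j\<in>UNIV. L $ i $ j *\<^sub>R centre v $ j) = mix L v $ i"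
      by (simp add: centre_def mix_def scaleR_right_diff_distrib sum_subtractf
          scaleR_sum_left[symmetric] row)
    have "(\<Sum>j\<in>UNIV. (if i = j then 1 else 0) *\<^sub>R centre v $ j) = (\<Sum>j\<in>UNIV. if i = j then centre v $ j else 0)"
      by (intro sum.cong) auto
    then have s2: "(\<Sum>j\<in>UNIV. (if i = j then 1 else 0) *\<^sub>R centre v $ j) = centre v $ i"
      by simp
    have "mix A (centre v) $ i = (\<Sum>j\<in>UNIV. (if i = j then 1 else 0) *\<^sub>R centre v $ j
      + L $ i $ j *\<^sub>R centre v $ j - c *\<^sub>R centre v $ j)"
      unfolding mix_def by (simp only: vec_lambda_beta A scaleR_left_diff_distrib scaleR_left_distrib)
    then show ?thesis by (simp only: sum_subtractf sum.distrib s0 s1 s2 diff_zero)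
  qed
  then show ?thesis by (simp add: vec_eq_iff)
qed

text \<open>The inner dimension of the product of the column and the row is an arbitrary type, so the
  product is only a multiple of the all-ones matrix.\<close>

lemma deviation_matrix_nth:
  fixes L :: "real^'m^'m"
  shows "(mat 1 + L - (1 / real CARD('m)) *\<^sub>R
      (columnvector (1::real^'m) ** (rowvector (1::real^'m) :: real^'m^'k))) $ i $ j
    = (if i = j then 1 else 0) + L $ i $ j - real CARD('k) / real CARD('m)"
  by (simp add: mat_def matrix_matrix_mult_def columnvector_def rowvector_def)

text \<open>The diagonal of \<open>L\<close> absorbs the terms with the agent's own state. The noise
  has no such term, as an agent does not receive its own message, so it enters through the
  off-diagonal part of \<open>L\<close>.\<close>

lemma neighbor_sum_eq_mix:
  fixes L :: "real^'m^'m" and v z :: "real^'d^'m"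
  assumes offdiag: "\<And>i j. i \<noteq> j \<Longrightarrow> L $ i $ j \<ge> 0"
    and diag: "\<And>i. L $ i $ i = - (\<Sum>j\<in>neighbors L i. L $ i $ j)"
  shows "(\<Sum>j\<in>neighbors L i. L $ i $ j *\<^sub>R (v $ j + z $ j - v $ i))
    = mix L v $ i + mix (\<chi> i j. if j \<in> neighbors L i then L $ i $ j else 0) z $ i"
proof -
  have "(\<Sum>j\<in>UNIV. L $ i $ j *\<^sub>R v $ j)
      = L $ i $ i *\<^sub>R v $ i + (\<Sum>j\<in>UNIV - {i}. L $ i $ j *\<^sub>R v $ j)"
    by (simp add: sum.remove[of UNIV i])
  also have "(\<Sum>j\<in>UNIV - {i}. L $ i $ j *\<^sub>R v $ j) = (\<Sum>j\<in>neighbors L i. L $ i $ j *\<^sub>R v $ j)"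
  proof (rule sum.mono_neutral_right)
    show "\<forall>j\<in>UNIV - {i} - neighbors L i. L $ i $ j *\<^sub>R v $ j = 0"
    proof
      fix j assume "j \<in> UNIV - {i} - neighbors L i"
      then have "L $ i $ j = 0" using offdiag[of i j] by (auto simp: neighbors_def)
      then show "L $ i $ j *\<^sub>R v $ j = 0" by simp
    qed
  qed (auto simp: neighbors_def)
  finally have 1: "mix L v $ i = (\<Sum>j\<in>neighbors L i. L $ i $ j *\<^sub>R (v $ j - v $ i))"
    by (simp add: mix_def diag scaleR_right_diff_distrib sum_subtractf scaleR_sum_left)
  have "mix (\<chi> i j. if j \<in> neighbors L i then L $ i $ j else 0) z $ i
      = (\<Sum>j\<in>UNIV. if j \<in> neighbors L i then L $ i $ j *\<^sub>R z $ j else 0)"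
    unfolding mix_def by (simp, intro sum.cong) auto
  also have "\<dots> = (\<Sum>j\<in>neighbors L i. L $ i $ j *\<^sub>R z $ j)"
    by (simp add: sum.If_cases)
  finally show ?thesis
    unfolding 1 by (simp add: scaleR_right_distrib scaleR_right_diff_distrib sum.distrib sum_subtractf)
qed

section \<open>Convergence of the algorithm\<close>

theorem theorem1:
  fixes M :: "'w measure"
    and L :: "real^'m^'m"
    and cw al \<gamma> :: "nat \<Rightarrow> real"
    and C :: real
    and r :: "'m \<Rightarrow> nat \<Rightarrow> real^'d"
    and \<sigma> :: "'m \<Rightarrow> nat \<Rightarrow> real"
    and \<zeta> x :: "'m \<Rightarrow> nat \<Rightarrow> 'w \<Rightarrow> real^'d"
  assumes prob: "prob_space M"
    and L_offdiag: "\<And>i j. i \<noteq> j \<Longrightarrow> L $ i $ j \<ge> 0"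
    and L_diag: "\<And>i. L $ i $ i = - (\<Sum>j\<in>neighbors L i. L $ i $ j)"
    and cw_pos: "\<And>k. cw k > 0"
    and al_pos: "\<And>k. al k > 0"
    and x_init: "\<And>i \<omega>. \<omega> \<in> space M \<Longrightarrow> x i 0 \<omega> = r i 0"
    and x_step: "\<And>i k \<omega>. \<omega> \<in> space M \<Longrightarrow>
        x i (Suc k) \<omega> = (1 - al k) *\<^sub>R x i k \<omega>
          + cw k *\<^sub>R (\<Sum>j\<in>neighbors L i. L $ i $ j *\<^sub>R (x j k \<omega> + \<zeta> j k \<omega> - x i k \<omega>))
          + r i (Suc k) - (1 - al k) *\<^sub>R r i k"
    and A1_sym: "transpose L = L"
    and A1_col: "1 v* L = 0"
    and A1_row: "L *v 1 = 0"
    and A1_norm: "onorm ((*v) (mat 1 + L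
        - (1 / real CARD('m)) *\<^sub>R (columnvector (1::real^'m) ** rowvector (1::real^'m)))) < 1"
    and A2_meas: "\<And>i k. \<zeta> i k \<in> borel_measurable M"
    and A2_mean: "\<And>i k. AE \<omega> in M. vec_cond_exp M (gen_algebra M (x i k) borel) (\<zeta> i k) \<omega> = 0"
    and A2_var: "\<And>i k. AE \<omega> in M.
        nn_cond_exp M (gen_algebra M (x i k) borel) (\<lambda>\<omega>'. ennreal ((norm (\<zeta> i k \<omega>'))\<^sup>2)) \<omega>
          = ennreal ((\<sigma> i k)\<^sup>2)"
    and A2_sum: "summable (\<lambda>k. (cw k)\<^sup>2 * (MAX i. (\<sigma> i k)\<^sup>2))"
    and A2_indep: "prob_space.indep_vars M (\<lambda>_. borel) (\<lambda>(i, k). \<zeta> i k) UNIV"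
    and A2_indep_init: "prob_space.indep_set M
        (sets (gen_algebra M (\<lambda>\<omega> (i, k). \<zeta> i k \<omega>) (PiM UNIV (\<lambda>_. borel))))
        (sets (gen_algebra M (\<lambda>\<omega> i. x i 0 \<omega>) (PiM UNIV (\<lambda>_. borel))))"
    and A2_init: "\<And>i. integrable M (\<lambda>\<omega>. (norm (x i 0 \<omega>))\<^sup>2)"
    and A3_nonneg: "\<And>k. \<gamma> k \<ge> 0"
    and A3_bound: "\<And>i k. norm (r i (Suc k) - (1 - al k) *\<^sub>R r i k) \<le> \<gamma> k * C"
    and A3_pos: "\<forall>\<^sub>F k in sequentially. \<gamma> k > 0"
    and A3_ratio: "convergent (\<lambda>k. al k / \<gamma> k)"
    and A4_al: "filterlim (\<lambda>n. \<Sum>k<n. al k) at_top sequentially"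
    and A4_cw: "filterlim (\<lambda>n. \<Sum>k<n. cw k) at_top sequentially"
    and A4_cw2: "summable (\<lambda>k. (cw k)\<^sup>2)"
    and A4_ratio: "summable (\<lambda>k. (\<gamma> k)\<^sup>2 / cw k)"
  shows "AE \<omega> in M.
      (\<forall>i. (\<lambda>k. norm (x i k \<omega> - agent_mean (\<lambda>j. r j k))) \<longlonglongrightarrow> 0)
    \<and> summable (\<lambda>k. cw k * (\<Sum>i\<in>UNIV. (norm (x i k \<omega> - agent_mean (\<lambda>j. x j k \<omega>)))\<^sup>2))
    \<and> summable (\<lambda>k. \<gamma> k * (\<Sum>i\<in>UNIV. norm (x i k \<omega> - agent_mean (\<lambda>j. x j k \<omega>))))"
proof -
  interpret prob_space M by (rule prob)

  \<comment> \<open>Contraction constant, row sums and column sums\<close>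
  have al_ge: "0 \<le> al k" and cw_ge: "0 \<le> cw k" for k
    using al_pos[of k] cw_pos[of k] by auto

  \<comment> \<open>The inner dimension of the product in \<open>A1_norm\<close> is an inferred
    type, so the matrix is captured by unification instead of being written out.\<close>
  have "\<exists>A c. onorm ((*v) A) < 1 \<and> (\<forall>i j. A $ i $ j = (if i = j then 1 else 0) + L $ i $ j - c)"
    by (rule exI, rule exI, rule conjI, rule A1_norm, intro allI, rule deviation_matrix_nth)
  then obtain A :: "real^'m^'m" and c where A_norm: "onorm ((*v) A) < 1"
    and A_nth: "\<And>i j. A $ i $ j = (if i = j then 1 else 0) + L $ i $ j - c" by blast
  define \<rho> where "\<rho> = onorm ((*v) A)"
  define \<delta> where "\<delta> = 1 - \<rho>"
  have "\<rho> < 1" using A_norm by (simp add: \<rho>_def)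
  moreover have "0 \<le> \<rho>" by (simp add: \<rho>_def onorm_pos_le)
  ultimately have \<rho>: "0 \<le> \<rho>" "\<rho> < 1" and \<delta>: "0 < \<delta>" "\<delta> \<le> 1" by (auto simp: \<delta>_def)
  have A_le: "norm (mix A w) \<le> \<rho> * norm w" for w :: "real^'d^'m"
    unfolding \<rho>_def by (rule norm_mix_le)
  have row: "(\<Sum>j\<in>UNIV. L $ i $ j) = 0" for i
    using arg_cong[OF A1_row, of "\<lambda>u. u $ i"] by (simp add: matrix_vector_mult_def)
  have col: "(\<Sum>i\<in>UNIV. L $ i $ j) = 0" for j
    using arg_cong[OF A1_col, of "\<lambda>u. u $ j"] by (simp add: vector_matrix_mult_def)
  have A_centre: "mix A (centre v) = centre v + mix L v" for v :: "real^'d^'m"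
    by (rule mix_deviation_matrix[OF row A_nth])

  \<comment> \<open>The stacked recursion\<close>
  define X where "X k \<omega> = (\<chi> i. x i k \<omega>)" for k \<omega>
  define Z where "Z k \<omega> = (\<chi> i. \<zeta> i k \<omega>)" for k \<omega>
  define R where "R k = (\<chi> i. r i k)" for k
  define G where "G k = R (Suc k) - (1 - al k) *\<^sub>R R k" for k
  define L0 :: "real^'m^'m" where "L0 = (\<chi> i j. if j \<in> neighbors L i then L $ i $ j else 0)"
  have X_0: "X 0 \<omega> = R 0" if "\<omega> \<in> space M" for \<omega>
    using that by (simp add: X_def R_def x_init)
  have X_step: "X (Suc k) \<omega> = (1 - al k) *\<^sub>R X k \<omega> + cw k *\<^sub>R (mix L (X k \<omega>) + mix L0 (Z k \<omega>)) + G k"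
    if "\<omega> \<in> space M" for k \<omega>
  proof -
    have "X (Suc k) \<omega> $ i
      = ((1 - al k) *\<^sub>R X k \<omega> + cw k *\<^sub>R (mix L (X k \<omega>) + mix L0 (Z k \<omega>)) + G k) $ i" for i
      using neighbor_sum_eq_mix[OF L_offdiag L_diag, of i "X k \<omega>" "Z k \<omega>"]
      by (simp add: X_def Z_def G_def R_def L0_def x_step[OF that])
    then show ?thesis by (simp add: vec_eq_iff)
  qed

  \<comment> \<open>Moments and convergence of the noise\<close>
  have x_meas: "x i k \<in> borel_measurable M" for i k
  proof (induction k arbitrary: i)
    case 0
    show ?case by (subst measurable_cong[OF x_init]) auto
  next
    case (Suc k)
    note [measurable] = Suc A2_meas
    show ?case by (subst measurable_cong[OF x_step]) measurable
  qed
  \<comment> \<open>Measurability of the states makes the conditioning algebras subalgebras of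
    \<open>M\<close>.\<close>
  note \<zeta>_mom = moments_from_conditional_moments[OF x_meas A2_meas A2_mean A2_var]
  note \<zeta>_inner = \<zeta>_mom(3) and \<zeta>_mean = \<zeta>_mom(4)
  define s where "s k = (\<Sum>i\<in>UNIV. (\<sigma> i k)\<^sup>2)" for k
  have Z_norm: "(norm (Z k \<omega>))\<^sup>2 = (\<Sum>i\<in>UNIV. (norm (\<zeta> i k \<omega>))\<^sup>2)" for k \<omega>
    by (simp add: power2_norm_eq_inner inner_vec_def Z_def)
  have Z_inner: "Z k \<omega> \<bullet> a = (\<Sum>i\<in>UNIV. \<zeta> i k \<omega> \<bullet> a $ i)" for k \<omega> a
    by (simp add: inner_vec_def Z_def)
  have Z_meas[measurable]: "Z k \<in> borel_measurable M" for k
  proof -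
    note [measurable] = A2_meas
    have "(\<lambda>\<omega>. Z k \<omega> \<bullet> a) \<in> borel_measurable M" for a
      unfolding Z_inner by measurable
    then show ?thesis by (subst borel_measurable_euclidean_space) auto
  qed
  have Z_sq: "integrable M (\<lambda>\<omega>. (norm (Z k \<omega>))\<^sup>2)" for k
    unfolding Z_norm using \<zeta>_mom(1) by simp
  have Z_var: "expectation (\<lambda>\<omega>. (norm (Z k \<omega>))\<^sup>2) = s k" for k
    unfolding Z_norm s_def using \<zeta>_mom(1,2) by simp
  have Z_mean: "expectation (\<lambda>\<omega>. Z k \<omega> \<bullet> a) = 0" for k a
    unfolding Z_inner using \<zeta>_inner \<zeta>_mean by simp
  have \<zeta>_sq_inner: "integrable M (\<lambda>\<omega>. (\<zeta> i k \<omega> \<bullet> a) * (\<zeta> j l \<omega> \<bullet> b))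
    \<and> expectation (\<lambda>\<omega>. (\<zeta> i k \<omega> \<bullet> a) * (\<zeta> j l \<omega> \<bullet> b)) = 0" if "k \<noteq> l" for i j k l a b
  proof -
    have "indep_var borel (\<lambda>\<omega>. \<zeta> i k \<omega> \<bullet> a) borel (\<lambda>\<omega>. \<zeta> j l \<omega> \<bullet> b)"
      using indep_var_inner[OF A2_indep, of "(i, k)" "(j, l)" a b] that by simp
    from indep_var_integrable[OF this \<zeta>_inner \<zeta>_inner] indep_var_lebesgue_integral[OF this \<zeta>_inner \<zeta>_inner]
    show ?thesis by (simp add: \<zeta>_mean)
  qed
  have Z_uncorr: "expectation (\<lambda>\<omega>. (Z k \<omega> \<bullet> a) * (Z l \<omega> \<bullet> b)) = 0" if "k < l" for k l a b
    unfolding Z_inner sum_product using \<zeta>_sq_inner that by simp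
  have s_nonneg: "0 \<le> s k" for k by (simp add: s_def sum_nonneg)
  have s_sum: "summable (\<lambda>k. (cw k)\<^sup>2 * s k)"
  proof (rule summable_comparison_test')
    show "summable (\<lambda>k. real CARD('m) * ((cw k)\<^sup>2 * (MAX i. (\<sigma> i k)\<^sup>2)))"
      by (intro summable_mult A2_sum)
    fix k
    have "s k \<le> real CARD('m) * (MAX i. (\<sigma> i k)\<^sup>2)"
      unfolding s_def by (rule sum_bounded_above) auto
    from mult_left_mono[OF this, of "(cw k)\<^sup>2"]
    show "norm ((cw k)\<^sup>2 * s k) \<le> real CARD('m) * ((cw k)\<^sup>2 * (MAX i. (\<sigma> i k)\<^sup>2))"
      using s_nonneg by (simp add: mult.left_commute)
  qed
  \<comment> \<open>The series is treated agent by agent: for fixed \<open>i\<close> the noises form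
    a subfamily of the independent family, so no grouping into independent stacked vectors is
    required.\<close>
  have noise_conv: "AE \<omega> in M. convergent (\<lambda>n. \<Sum>k<n. cw k *\<^sub>R Z k \<omega>)"
  proof -
    have "AE \<omega> in M. convergent (\<lambda>n. \<Sum>k<n. cw k *\<^sub>R \<zeta> i k \<omega>)" for i
    proof (rule AE_convergent_sum)
      have "indep_vars (\<lambda>_. borel) (\<lambda>k. \<zeta> i k) UNIV"
        using indep_vars_reindex_inj[OF A2_indep, of "\<lambda>k. (i, k)" UNIV] by (simp add: inj_on_def)
      then show "indep_vars (\<lambda>_. borel) (\<lambda>k \<omega>. cw k *\<^sub>R \<zeta> i k \<omega>) UNIV"
        by (rule indep_vars_compose2) simp
      show "integrable M (\<lambda>\<omega>. (norm (cw k *\<^sub>R \<zeta> i k \<omega>))\<^sup>2)" for k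
        using \<zeta>_mom(1) by (simp add: power_mult_distrib)
      show "expectation (\<lambda>\<omega>. cw k *\<^sub>R \<zeta> i k \<omega> \<bullet> b) = 0" for k b
        using \<zeta>_mean by simp
      show "summable (\<lambda>k. expectation (\<lambda>\<omega>. (norm (cw k *\<^sub>R \<zeta> i k \<omega>))\<^sup>2))"
      proof (rule summable_comparison_test'[OF s_sum])
        fix k
        have "(\<sigma> i k)\<^sup>2 \<le> s k" unfolding s_def by (rule member_le_sum) auto
        then show "norm (expectation (\<lambda>\<omega>. (norm (cw k *\<^sub>R \<zeta> i k \<omega>))\<^sup>2)) \<le> (cw k)\<^sup>2 * s k"
          using \<zeta>_mom(2) by (simp add: power_mult_distrib mult_left_mono)
      qed
    qed
    then have "AE \<omega> in M. \<forall>i\<in>UNIV. convergent (\<lambda>n. \<Sum>k<n. cw k *\<^sub>R \<zeta> i k \<omega>)"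
      by (intro AE_finite_allI) auto
    then show ?thesis
    proof eventually_elim
      case (elim \<omega>)
      then have "\<forall>i. \<exists>l. (\<lambda>n. (\<Sum>k<n. cw k *\<^sub>R Z k \<omega>) $ i) \<longlonglongrightarrow> l"
        by (simp add: convergent_def Z_def)
      then obtain l where l: "\<And>i. (\<lambda>n. (\<Sum>k<n. cw k *\<^sub>R Z k \<omega>) $ i) \<longlonglongrightarrow> l i" by metis
      have "(\<lambda>n. \<Sum>k<n. cw k *\<^sub>R Z k \<omega>) \<longlonglongrightarrow> (\<chi> i. l i)"
        by (rule vec_tendstoI, unfold vec_lambda_beta, rule l)
      then show ?case by (rule convergentI)
    qed
  qed

  \<comment> \<open>Consequences of the stepsize conditions\<close>
  obtain D where D: "0 < D" "\<And>k. \<bar>al k / \<gamma> k\<bar> \<le> D"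
    using convergent_imp_Bseq[OF A3_ratio] unfolding Bseq_def by auto
  \<comment> \<open>Multiplying by \<open>\<gamma> k\<close> needs \<open>\<gamma> k > 0\<close>: at
    0 the quotient is 0 by convention and says nothing about \<open>al k\<close>.\<close>
  have al_le: "\<forall>\<^sub>F k in sequentially. al k \<le> D * \<gamma> k"
    using A3_pos
  proof eventually_elim
    case (elim k)
    then show ?case using abs_le_D1[OF D(2)[of k]] by (simp add: pos_divide_le_eq)
  qed
  have cw_lim: "cw \<longlonglongrightarrow> 0"
    using tendsto_real_sqrt[OF summable_LIMSEQ_zero[OF A4_cw2]] cw_ge by simp
  have \<gamma>_lim: "\<gamma> \<longlonglongrightarrow> 0"
  proof -
    have "(\<lambda>k. (\<gamma> k)\<^sup>2 / cw k * cw k) \<longlonglongrightarrow> 0 * 0"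
      by (intro tendsto_mult summable_LIMSEQ_zero[OF A4_ratio] cw_lim)
    moreover have "(\<gamma> k)\<^sup>2 / cw k * cw k = (\<gamma> k)\<^sup>2" for k
      using cw_pos[of k] by simp
    ultimately have "(\<lambda>k. (\<gamma> k)\<^sup>2) \<longlonglongrightarrow> 0" by simp
    from tendsto_real_sqrt[OF this] show ?thesis using A3_nonneg by simp
  qed
  have al_lim: "al \<longlonglongrightarrow> 0"
  proof (rule tendsto_sandwich[OF _ al_le tendsto_const])
    show "(\<lambda>k. D * \<gamma> k) \<longlonglongrightarrow> 0" using \<gamma>_lim by (rule tendsto_mult_right_zero)
  qed (simp add: al_ge)
  have al_cw: "\<forall>\<^sub>F k in sequentially. al k + cw k \<le> 1"
  proof -
    have "(\<lambda>k. al k + cw k) \<longlonglongrightarrow> 0" using tendsto_add[OF al_lim cw_lim] by simp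
    from order_tendstoD(2)[OF this, of 1] show ?thesis by (auto elim: eventually_mono)
  qed

  define p where "p k = \<delta> * cw k" for k
  have p_pos: "0 < p k" for k using \<delta> cw_pos[of k] by (simp add: p_def)
  have p_le: "\<forall>\<^sub>F k in sequentially. p k \<le> 1"
    using al_cw
  proof eventually_elim
    case (elim k)
    have "p k \<le> 1 * cw k" unfolding p_def using \<delta> cw_ge by (intro mult_right_mono)
    then show ?case using elim al_ge[of k] by simp
  qed
  have p_div: "filterlim (\<lambda>n. \<Sum>k<n. p k) at_top sequentially"
    unfolding p_def sum_distrib_left[symmetric]
    by (rule filterlim_tendsto_pos_mult_at_top[OF tendsto_const \<delta>(1) A4_cw])
  have over_p: "summable (\<lambda>k. (f k)\<^sup>2 / p k)" if "summable (\<lambda>k. (f k)\<^sup>2 / cw k)" for f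
    using summable_divide[OF that, of \<delta>] by (simp add: p_def mult.commute)
  \<comment> \<open>No bound of \<open>al\<close> by a multiple of \<open>cw\<close> is available.
    This square summability lets \<open>al\<close> act as the perturbation \<open>q\<close> of the
    path argument.\<close>
  have al_sum: "summable (\<lambda>k. (al k)\<^sup>2 / p k)"
  proof (rule over_p, rule summable_comparison_test_ev)
    show "summable (\<lambda>k. D\<^sup>2 * ((\<gamma> k)\<^sup>2 / cw k))" by (intro summable_mult A4_ratio)
    show "\<forall>\<^sub>F k in sequentially. norm ((al k)\<^sup>2 / cw k) \<le> D\<^sup>2 * ((\<gamma> k)\<^sup>2 / cw k)"
      using al_le
    proof eventually_elim
      case (elim k)
      have "(al k)\<^sup>2 \<le> (D * \<gamma> k)\<^sup>2" using elim al_ge by (rule power_mono)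
      then have "(al k)\<^sup>2 / cw k \<le> (D * \<gamma> k)\<^sup>2 / cw k" using cw_ge by (rule divide_right_mono)
      then show ?case using cw_ge[of k] by (simp add: power_mult_distrib)
    qed
  qed

  \<comment> \<open>Deviations from the average\<close>
  define \<Phi> :: "real^'d^'m \<Rightarrow> real^'d^'m" where "\<Phi> = centre \<circ> mix L0"
  have \<Phi>_lin: "linear \<Phi>" unfolding \<Phi>_def by (intro linear_compose linear_mix linear_centre)
  define V where "V k \<omega> = centre (X k \<omega>)" for k \<omega>
  \<comment> \<open>Columns of \<open>L0\<close> need not sum to zero, so the mixed noise has an
    average of its own; centring removes it here, and it reappears as the noise of
    \<open>U\<close>.\<close>
  define N where "N k \<omega> = cw k *\<^sub>R \<Phi> (Z k \<omega>)" for k \<omega>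
  \<comment> \<open>On centred vectors this is
    \<open>(1 - al k) *\<^sub>R w + cw k *\<^sub>R mix L w\<close>. Written with \<open>A\<close> it
    contracts on the whole space.\<close>
  define T :: "nat \<Rightarrow> real^'d^'m \<Rightarrow> real^'d^'m"
    where "T k w = (1 - al k - cw k) *\<^sub>R w + cw k *\<^sub>R mix A w" for k w
  have V_0: "V 0 \<omega> = centre (R 0)" if "\<omega> \<in> space M" for \<omega>
    using that by (simp add: V_def X_0)
  have V_step: "V (Suc k) \<omega> = T k (V k \<omega>) + centre (G k) + N k \<omega>" if "\<omega> \<in> space M" for k \<omega>
  proof -
    have "centre (mix L v) = mix L v" for v :: "real^'d^'m"
      using mean_state_mix[OF col, of v] by (simp add: centre_def vec_eq_iff)
    then show ?thesis
      unfolding V_def T_def N_def A_centre \<Phi>_def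
      by (simp add: X_step[OF that] linear_add[OF linear_centre] linear_diff[OF linear_centre] linear_scale[OF linear_centre]
          scaleR_right_distrib scaleR_left_diff_distrib)
  qed
  have T_lin: "linear (T k)" for k
    unfolding T_def by (intro linear_compose_add linear_compose_scale_right linear_mix linear_id[unfolded id_def])
  have T_contr: "\<forall>\<^sub>F k in sequentially. \<forall>w. norm (T k w) \<le> (1 - p k) * norm w"
    using al_cw
  proof eventually_elim
    case (elim k)
    show ?case
    proof
      fix w
      have "norm (T k w) \<le> norm ((1 - al k - cw k) *\<^sub>R w) + norm (cw k *\<^sub>R mix A w)"
        unfolding T_def by (rule norm_triangle_ineq)
      also have "\<dots> \<le> (1 - al k - cw k) * norm w + cw k * (\<rho> * norm w)"
        using elim cw_ge[of k] A_le[of w] by (intro add_mono) (auto intro: mult_left_mono)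
      \<comment> \<open>The coefficients add up to \<open>1 - al k - \<delta> * cw k\<close>; the
        extra decrease from \<open>al k\<close> is given away.\<close>
      also have "\<dots> = (1 - p k) * norm w - al k * norm w"
        by (simp add: p_def \<delta>_def algebra_simps)
      finally show "norm (T k w) \<le> (1 - p k) * norm w"
        using mult_nonneg_nonneg[OF al_ge[of k] norm_ge_zero[of w]] by linarith
    qed
  qed
  \<comment> \<open>Both \<open>w\<close> and \<open>mix A w\<close> contribute
    \<open>cw k * norm w\<close>, which is where \<open>2 / \<delta> * p k\<close> comes
    from.\<close>
  have T_id: "norm (w - T k w) \<le> (2 / \<delta> * p k + al k) * norm w" for k w
  proof -
    have "w - T k w = (al k + cw k) *\<^sub>R w - cw k *\<^sub>R mix A w"
      by (simp add: T_def algebra_simps)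
    then have "norm (w - T k w) \<le> norm ((al k + cw k) *\<^sub>R w) + norm (cw k *\<^sub>R mix A w)"
      by (simp only: norm_triangle_ineq4)
    also have "\<dots> \<le> (al k + cw k) * norm w + cw k * (1 * norm w)"
    proof -
      have "norm (mix A w) \<le> 1 * norm w"
        using A_le[of w] mult_right_mono[of \<rho> 1 "norm w"] \<rho> by simp
      then show ?thesis using al_ge[of k] cw_ge[of k] by (auto intro!: mult_left_mono)
    qed
    also have "\<dots> = (2 / \<delta> * p k + al k) * norm w"
      using \<delta> by (simp add: p_def algebra_simps)
    finally show ?thesis .
  qed
  obtain B where B: "0 < B" "\<And>v. norm (centre v) \<le> B * norm (v :: real^'d^'m)"
    using linear_bounded_pos[OF linear_centre] by blast
  define c where "c k = B * (real CARD('m) * C) * \<gamma> k" for k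
  have G_le: "norm (centre (G k)) \<le> c k" for k
  proof -
    have "norm (G k) \<le> (\<Sum>i\<in>UNIV. norm (G k $ i))" unfolding norm_vec_def by (rule L2_set_le_sum) simp
    also have "\<dots> \<le> real CARD('m) * (\<gamma> k * C)"
      using A3_bound by (intro sum_bounded_above) (simp add: G_def R_def)
    finally have "B * norm (G k) \<le> B * (real CARD('m) * (\<gamma> k * C))"
      using B(1) by (intro mult_left_mono) auto
    then show ?thesis using B(2)[of "G k"] by (simp add: c_def mult_ac)
  qed
  have c_sum: "summable (\<lambda>k. (c k)\<^sup>2 / p k)"
  proof (rule over_p)
    show "summable (\<lambda>k. (c k)\<^sup>2 / cw k)"
      using summable_mult[OF A4_ratio, of "(B * (real CARD('m) * C))\<^sup>2"]
      by (simp add: c_def power_mult_distrib)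
  qed
  obtain B' where B': "0 < B'" "\<And>v. norm (\<Phi> v) \<le> B' * norm v"
    using linear_bounded_pos[OF \<Phi>_lin] by blast
  have [measurable]: "\<Phi> \<in> borel_measurable borel"
    by (intro borel_measurable_continuous_onI linear_continuous_on linear_conv_bounded_linear[THEN iffD1] \<Phi>_lin)
  have N_meas: "N k \<in> borel_measurable M" for k unfolding N_def by measurable
  have N_le: "(norm (N k \<omega>))\<^sup>2 \<le> (cw k)\<^sup>2 * B'\<^sup>2 * (norm (Z k \<omega>))\<^sup>2" for k \<omega>
  proof -
    have "norm (N k \<omega>) \<le> cw k * (B' * norm (Z k \<omega>))"
      using B'(2) cw_ge[of k] by (simp add: N_def mult_left_mono)
    then have "(norm (N k \<omega>))\<^sup>2 \<le> (cw k * (B' * norm (Z k \<omega>)))\<^sup>2" by (intro power_mono) auto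
    then show ?thesis by (simp add: power_mult_distrib mult.assoc)
  qed
  have N_sq: "integrable M (\<lambda>\<omega>. (norm (N k \<omega>))\<^sup>2)" for k
  proof (rule Bochner_Integration.integrable_bound)
    show "integrable M (\<lambda>\<omega>. (cw k)\<^sup>2 * B'\<^sup>2 * (norm (Z k \<omega>))\<^sup>2)" using Z_sq by simp
  qed (use N_le N_meas in auto)
  have N_sum: "summable (\<lambda>k. expectation (\<lambda>\<omega>. (norm (N k \<omega>))\<^sup>2))"
  proof (rule summable_comparison_test'[OF summable_mult[OF s_sum, of "B'\<^sup>2"]])
    fix k
    have "expectation (\<lambda>\<omega>. (norm (N k \<omega>))\<^sup>2) \<le> expectation (\<lambda>\<omega>. (cw k)\<^sup>2 * B'\<^sup>2 * (norm (Z k \<omega>))\<^sup>2)"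
      using N_sq Z_sq N_le by (intro integral_mono) auto
    then show "norm (expectation (\<lambda>\<omega>. (norm (N k \<omega>))\<^sup>2)) \<le> B'\<^sup>2 * ((cw k)\<^sup>2 * s k)"
      by (simp add: Z_var mult_ac)
  qed
  \<comment> \<open>Moving \<open>\<Phi>\<close> to the test direction reduces means and
    correlations of \<open>N\<close> to those of \<open>Z\<close>.\<close>
  have N_inner: "N k \<omega> \<bullet> a = cw k * (Z k \<omega> \<bullet> adjoint \<Phi> a)" for k \<omega> a
    by (simp add: N_def adjoint_works[OF \<Phi>_lin])
  have N_mean: "expectation (\<lambda>\<omega>. N k \<omega> \<bullet> a) = 0" for k a
    unfolding N_inner by (simp add: Z_mean)
  have N_uncorr: "expectation (\<lambda>\<omega>. (N k \<omega> \<bullet> a) * (N l \<omega> \<bullet> b)) = 0" if "k < l" for k l a b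
  proof -
    have "expectation (\<lambda>\<omega>. (N k \<omega> \<bullet> a) * (N l \<omega> \<bullet> b))
      = expectation (\<lambda>\<omega>. cw k * cw l * ((Z k \<omega> \<bullet> adjoint \<Phi> a) * (Z l \<omega> \<bullet> adjoint \<Phi> b)))"
      unfolding N_inner by (simp add: mult_ac)
    then show ?thesis using Z_uncorr[OF that] by simp
  qed
  have V_sum: "AE \<omega> in M. summable (\<lambda>k. p k * (norm (V k \<omega>))\<^sup>2)"
    by (rule AE_summable_contracting_recursion[where T=T and N=N and c=c and g="\<lambda>k. centre (G k)"])
      (fact V_0 V_step T_lin N_meas N_sq N_mean N_uncorr T_contr G_le p_pos p_le c_sum N_sum)+

  \<comment> \<open>The average state against the average reference\<close>
  define \<Psi> :: "real^'d^'m \<Rightarrow> real^'d" where "\<Psi> = mean_state \<circ> mix L0"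
  have \<Psi>_lin: "linear \<Psi>" unfolding \<Psi>_def by (intro linear_compose linear_mix linear_mean_state)
  define U where "U k \<omega> = mean_state (X k \<omega>) - mean_state (R k)" for k \<omega>
  \<comment> \<open>Zero column sums remove the mixing of the states, and the average of
    \<open>G k\<close> cancels against the reference recursion. The explicit 0 stands for the drift
    in the general recursion.\<close>
  have U_step: "U (Suc k) \<omega> = (1 - al k) *\<^sub>R U k \<omega> + 0 + cw k *\<^sub>R \<Psi> (Z k \<omega>)" if "\<omega> \<in> space M" for k \<omega>
    unfolding U_def \<Psi>_def G_def
    by (simp add: X_step[OF that] G_def linear_add[OF linear_mean_state] linear_diff[OF linear_mean_state]
        linear_scale[OF linear_mean_state] mean_state_mix[OF col] algebra_simps)
  \<comment> \<open>One almost sure event, convergence of the stacked noise series, thus serves both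
    \<open>V\<close> and \<open>U\<close>.\<close>
  have lin_conv: "convergent (\<lambda>n. \<Sum>k<n. cw k *\<^sub>R f (Z k \<omega>))"
    if f: "linear f" and conv: "convergent (\<lambda>n. \<Sum>k<n. cw k *\<^sub>R Z k \<omega>)"
    for f :: "real^'d^'m \<Rightarrow> 'e::euclidean_space" and \<omega>
  proof -
    obtain l where "(\<lambda>n. \<Sum>k<n. cw k *\<^sub>R Z k \<omega>) \<longlonglongrightarrow> l" using conv convergent_def by blast
    from bounded_linear.tendsto[OF linear_conv_bounded_linear[THEN iffD1, OF f] this]
    show ?thesis
      by (auto simp: linear_sum[OF f] linear_scale[OF f] intro: convergentI)
  qed

  \<comment> \<open>Conclusion along almost every path\<close>
  show ?thesis
    using noise_conv V_sum AE_space
  proof eventually_elim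
    case (elim \<omega>)
    have V_lim: "(\<lambda>k. V k \<omega>) \<longlonglongrightarrow> 0"
    proof (rule contracting_recursion_tendsto_0[where T=T and p=p and q=al and c=c and K="2 / \<delta>"
          and g="\<lambda>k. centre (G k)" and n="\<lambda>k. N k \<omega>"])
      show "convergent (\<lambda>m. \<Sum>k<m. N k \<omega>)"
        unfolding N_def using lin_conv[OF \<Phi>_lin] elim by blast
      show "V (Suc k) \<omega> = T k (V k \<omega>) + centre (G k) + N k \<omega>" for k
        using V_step elim by blast
      show "0 \<le> 2 / \<delta>" using \<delta> by simp
    qed (fact T_lin T_contr T_id G_le al_ge p_pos p_le p_div c_sum al_sum)+
    have U_lim: "(\<lambda>k. U k \<omega>) \<longlonglongrightarrow> 0"
    \<comment> \<open>Here the damping rate is \<open>al\<close> itself, and \<open>w\<close>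
      differs from its image by exactly \<open>al k *\<^sub>R w\<close>, whence \<open>K=1\<close>
      and \<open>q\<close> zero.\<close>
    proof (rule contracting_recursion_tendsto_0[where T="\<lambda>k w. (1 - al k) *\<^sub>R w" and p=al
          and q="\<lambda>_. 0" and c="\<lambda>_. 0" and K=1 and g="\<lambda>_. 0" and n="\<lambda>k. cw k *\<^sub>R \<Psi> (Z k \<omega>)"])
      show "U (Suc k) \<omega> = (1 - al k) *\<^sub>R U k \<omega> + 0 + cw k *\<^sub>R \<Psi> (Z k \<omega>)" for k
        using U_step elim by blast
      show "convergent (\<lambda>m. \<Sum>k<m. cw k *\<^sub>R \<Psi> (Z k \<omega>))"
        using lin_conv[OF \<Psi>_lin] elim by blast
      show "\<forall>\<^sub>F k in sequentially. al k \<le> 1"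
        using al_cw by eventually_elim (use cw_ge in \<open>smt (verit)\<close>)
      then show "\<forall>\<^sub>F k in sequentially. \<forall>w. norm ((1 - al k) *\<^sub>R w) \<le> (1 - al k) * norm (w :: real^'d)"
        by eventually_elim simp
      show "linear (\<lambda>w :: real^'d. (1 - al k) *\<^sub>R w)" for k
        by (rule linear_scale_self)
      show "norm (w - (1 - al k) *\<^sub>R w) \<le> (1 * al k + 0) * norm w" for k and w :: "real^'d"
        using al_ge[of k] by (simp add: scaleR_left_diff_distrib)
    qed (use al_pos A4_al in auto)
    have mean_x: "agent_mean (\<lambda>j. x j k \<omega>) = mean_state (X k \<omega>)" for k
      by (simp add: agent_mean_def mean_state_def X_def)
    have mean_r: "agent_mean (\<lambda>j. r j k) = mean_state (R k)" for k
      by (simp add: agent_mean_def mean_state_def R_def)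
    have dev: "x i k \<omega> - agent_mean (\<lambda>j. x j k \<omega>) = V k \<omega> $ i" for i k
      by (simp add: mean_x V_def centre_def X_def)
    have dev_sq: "(\<Sum>i\<in>UNIV. (norm (x i k \<omega> - agent_mean (\<lambda>j. x j k \<omega>)))\<^sup>2) = (norm (V k \<omega>))\<^sup>2" for k
      unfolding dev by (simp add: power2_norm_eq_inner inner_vec_def)
    have lim: "(\<lambda>k. norm (x i k \<omega> - agent_mean (\<lambda>j. r j k))) \<longlonglongrightarrow> 0" for i
    proof -
      have "(\<lambda>k. V k \<omega> $ i + U k \<omega>) \<longlonglongrightarrow> 0 $ i + 0"
        by (intro tendsto_add tendsto_vec_nth V_lim U_lim)
      moreover have "V k \<omega> $ i + U k \<omega> = x i k \<omega> - agent_mean (\<lambda>j. r j k)" for k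
        using dev[of i k] by (simp add: U_def mean_x mean_r algebra_simps)
      ultimately show ?thesis by (simp add: tendsto_norm_zero_iff)
    qed
    have sum_sq: "summable (\<lambda>k. cw k * (\<Sum>i\<in>UNIV. (norm (x i k \<omega> - agent_mean (\<lambda>j. x j k \<omega>)))\<^sup>2))"
      unfolding dev_sq
      using summable_divide[of "\<lambda>k. p k * (norm (V k \<omega>))\<^sup>2" \<delta>] elim \<delta> by (simp add: p_def)
    have "summable (\<lambda>k. \<gamma> k * (\<Sum>i\<in>UNIV. norm (x i k \<omega> - agent_mean (\<lambda>j. x j k \<omega>))))"
    proof (rule summable_comparison_test')
      show "summable (\<lambda>k. real CARD('m) * ((\<gamma> k)\<^sup>2 / cw k)
        + cw k * (\<Sum>i\<in>UNIV. (norm (x i k \<omega> - agent_mean (\<lambda>j. x j k \<omega>)))\<^sup>2))"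
        by (intro summable_add summable_mult A4_ratio sum_sq)
      fix k
      \<comment> \<open>AM-GM with weight \<open>cw k\<close>. It even bounds twice the left side;
        the spare factor is dropped.\<close>
      have le: "\<gamma> k * u \<le> (\<gamma> k)\<^sup>2 / cw k + cw k * u\<^sup>2" if "0 \<le> u" for u
      proof -
        have "0 \<le> (\<gamma> k - cw k * u)\<^sup>2 / cw k" using cw_ge[of k] by simp
        also have "\<dots> = (\<gamma> k)\<^sup>2 / cw k + cw k * u\<^sup>2 - 2 * (\<gamma> k * u)"
          using cw_pos[of k] by (simp add: field_simps power2_eq_square)
        finally show ?thesis using mult_nonneg_nonneg[OF A3_nonneg[of k] that] by linarith
      qed
      have "\<gamma> k * (\<Sum>i\<in>UNIV. norm (V k \<omega> $ i)) \<le> (\<Sum>i\<in>(UNIV :: 'm set). (\<gamma> k)\<^sup>2 / cw k + cw k * (norm (V k \<omega> $ i))\<^sup>2)"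
        unfolding sum_distrib_left by (intro sum_mono le) simp
      then show "norm (\<gamma> k * (\<Sum>i\<in>UNIV. norm (x i k \<omega> - agent_mean (\<lambda>j. x j k \<omega>))))
        \<le> real CARD('m) * ((\<gamma> k)\<^sup>2 / cw k)
          + cw k * (\<Sum>i\<in>UNIV. (norm (x i k \<omega> - agent_mean (\<lambda>j. x j k \<omega>)))\<^sup>2)"
        unfolding dev using A3_nonneg[of k]
        by (simp add: sum.distrib sum_distrib_left sum_nonneg abs_mult)
    qed
    with lim sum_sq show ?case by blast
  qed
qed

end
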